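(* Every finitely generated metabelian group $G$ is bounded, i.e. $1\le s(G)<\infty$, where $s(G)$ is the iterational depth of $G$.
   Context: Let $w=w(x_1,\dots,x_n)$ be a word (element of the free group $F_n$ on $x_1,\dots,x_n$, $n\ge 1$). Its Engel type iterations on the first variable are $w_{\circ 1}=w$ and $w_{\circ (N+1)}(x_1,\dots,x_n)=w(w_{\circ N}(x_1,\dots,x_n),x_2,\dots,x_n)$ for $N\ge 1$. A group $G$ satisfies the ($E$-type) iterated identity $w$ if for all $x_1,\dots,x_n\in G$ there exists $N\ge 1$ with $w_{\circ N}(x_1,\dots,x_n)=e$ in $G$. If $w$ is an iterated identity of $G$, the iterational depth $s(w,G)$ of $w$ in $G$ is the infimum (possibly $+\infty$) of those integers $D\ge 1$ such that for all $x_1,\dots,x_n\in G$ there is $1\le d\le D$ with $w_{\circ d}(x_1,\dots,x_n)=e$. A word is non-trivial if it is not equal to the identity in the free group. The iterational depth of $G$ is $s(G)=\sup_w s(w,G)$, the supremum over all non-trivial iterated identities $w$ (in any number of variables) satisfied by $G$; if $G$ satisfies no non-trivial iterated identity, $s(G)=-\infty$. $G$ is called bounded if $1\le s(G)<\infty$. *)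

theory Defs
  imports "HOL-Algebra.Algebra" "HOL-Library.Extended_Real"
begin

text \<open>The letter \<open>(i, True)\<close> stands for $x_i$ and \<open>(i, False)\<close> for $x_i^{-1}$; the variables of
  a word in $F_n$ are $x_1, \dots, x_n$.  Elements of $F_n$ are represented by their
  reduced words.\<close>

type_synonym letter = "nat \<times> bool"
type_synonym word = "letter list"

definition inv_letter :: "letter \<Rightarrow> letter" where
  "inv_letter a = (fst a, \<not> snd a)"

definition reduced :: "word \<Rightarrow> bool" where
  "reduced w \<longleftrightarrow> successively (\<lambda>a b. b \<noteq> inv_letter a) w"

fun red_cons :: "letter \<Rightarrow> word \<Rightarrow> word" where
  "red_cons a [] = [a]"
| "red_cons a (b # w) = (if b = inv_letter a then w else a # b # w)"

text \<open>For reduced \<open>u\<close> and \<open>v\<close>, \<open>foldr red_cons u v\<close> is the reduced form of \<open>u @ v\<close>.\<close>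

definition free_group :: "nat \<Rightarrow> word monoid" where
  "free_group n = \<lparr>carrier = {w. reduced w \<and> fst ` set w \<subseteq> {1..n}},
                   monoid.mult = foldr red_cons, one = []\<rparr>"

lemma inv_letter_inv_letter [simp]: "inv_letter (inv_letter a) = a"
  by (simp add: inv_letter_def)

lemma reduced_red_cons: "reduced w \<Longrightarrow> reduced (red_cons a w)"
  by (cases w) (auto simp: reduced_def successively_Cons)

lemma reduced_foldr_red_cons: "reduced v \<Longrightarrow> reduced (foldr red_cons u v)"
  by (induction u) (auto simp: reduced_red_cons)

lemma red_cons_cancel: "reduced w \<Longrightarrow> red_cons (inv_letter a) (red_cons a w) = w"
proof (cases w)
  case (Cons b v)
  assume "reduced w"
  then show ?thesis using Cons by (cases v) (auto simp: reduced_def)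
qed simp

lemma letters_red_cons: "set (red_cons a w) \<subseteq> insert a (set w)"
  by (cases w) auto

lemma letters_foldr_red_cons: "set (foldr red_cons u v) \<subseteq> set u \<union> set v"
proof (induction u)
  case (Cons a u)
  then show ?case using letters_red_cons[of a "foldr red_cons u v"] by auto
qed simp

lemma foldr_red_cons_red_cons:
  "reduced w \<Longrightarrow> foldr red_cons (red_cons a v) w = red_cons a (foldr red_cons v w)"
  using red_cons_cancel[OF reduced_foldr_red_cons, of w "inv_letter a"]
  by (cases v) auto

lemma foldr_red_cons_assoc:
  "reduced w \<Longrightarrow> foldr red_cons (foldr red_cons u v) w = foldr red_cons u (foldr red_cons v w)"
  by (induction u) (auto simp: foldr_red_cons_red_cons)

lemma foldr_red_cons_Nil: "reduced u \<Longrightarrow> foldr red_cons u [] = u"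
proof (induction u)
  case (Cons a u)
  then show ?case by (cases u) (auto simp: reduced_def)
qed simp

lemma foldr_red_cons_inverse:
  "reduced v \<Longrightarrow> foldr red_cons (rev (map inv_letter u)) (foldr red_cons u v) = v"
  by (induction u arbitrary: v) (auto simp: red_cons_cancel reduced_foldr_red_cons)

lemma reduced_inverse: "reduced u \<Longrightarrow> reduced (rev (map inv_letter u))"
  unfolding reduced_def successively_rev successively_map
  by (erule successively_mono) (auto simp: inv_letter_def)

lemma group_free_group: "group (free_group n)"
proof (rule groupI)
  fix u v assume "u \<in> carrier (free_group n)" "v \<in> carrier (free_group n)"
  then show "u \<otimes>\<^bsub>free_group n\<^esub> v \<in> carrier (free_group n)"
    using image_mono[OF letters_foldr_red_cons, of fst u v]
    by (simp add: free_group_def reduced_foldr_red_cons image_Un subset_trans)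
next
  fix u assume "u \<in> carrier (free_group n)"
  then show "\<exists>v\<in>carrier (free_group n). v \<otimes>\<^bsub>free_group n\<^esub> u = \<one>\<^bsub>free_group n\<^esub>"
    using foldr_red_cons_inverse[of "[]" u] reduced_inverse[of u]
    by (intro bexI[of _ "rev (map inv_letter u)"])
       (auto simp: free_group_def foldr_red_cons_Nil reduced_def inv_letter_def image_subset_iff)
qed (auto simp: free_group_def foldr_red_cons_assoc reduced_def)

definition word_eval :: "('a, 'b) monoid_scheme \<Rightarrow> (nat \<Rightarrow> 'a) \<Rightarrow> word \<Rightarrow> 'a" where
  "word_eval G x w =
     foldr (\<lambda>(i, s) g. (if s then x i else inv\<^bsub>G\<^esub> x i) \<otimes>\<^bsub>G\<^esub> g) w \<one>\<^bsub>G\<^esub>"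

text \<open>Substitution into a word is evaluation in the free group.  The iterations start at
  index 1; the value at 0 is never used.\<close>

fun engel_iter :: "nat \<Rightarrow> word \<Rightarrow> nat \<Rightarrow> word" where
  "engel_iter n w 0 = [(1, True)]"
| "engel_iter n w (Suc 0) = w"
| "engel_iter n w (Suc (Suc N)) =
     word_eval (free_group n) ((\<lambda>i. [(i, True)])(1 := engel_iter n w (Suc N))) w"

definition iterated_identity :: "('a, 'b) monoid_scheme \<Rightarrow> nat \<Rightarrow> word \<Rightarrow> bool" where
  "iterated_identity G n w \<longleftrightarrow>
     (\<forall>x \<in> {1..n} \<rightarrow> carrier G. \<exists>N\<ge>1. word_eval G x (engel_iter n w N) = \<one>\<^bsub>G\<^esub>)"

definition word_depth :: "('a, 'b) monoid_scheme \<Rightarrow> nat \<Rightarrow> word \<Rightarrow> ereal" where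
  "word_depth G n w = Inf {ereal (real D) | D. 1 \<le> D \<and>
     (\<forall>x \<in> {1..n} \<rightarrow> carrier G. \<exists>d\<in>{1..D}. word_eval G x (engel_iter n w d) = \<one>\<^bsub>G\<^esub>)}"

text \<open>In \<^typ>\<open>ereal\<close> the infimum of the empty set is \<open>\<infinity>\<close> and its supremum is \<open>-\<infinity>\<close>.\<close>

definition iterational_depth :: "('a, 'b) monoid_scheme \<Rightarrow> ereal" where
  "iterational_depth G = Sup {word_depth G n w | n w. 1 \<le> n \<and> w \<in> carrier (free_group n) \<and>
     w \<noteq> \<one>\<^bsub>free_group n\<^esub> \<and> iterated_identity G n w}"

definition iterationally_bounded :: "('a, 'b) monoid_scheme \<Rightarrow> bool" where
  "iterationally_bounded G \<longleftrightarrow> 1 \<le> iterational_depth G \<and> iterational_depth G < \<infinity>"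

definition finitely_generated :: "('a, 'b) monoid_scheme \<Rightarrow> bool" where
  "finitely_generated G \<longleftrightarrow> (\<exists>S \<subseteq> carrier G. finite S \<and> generate G S = carrier G)"

definition metabelian :: "('a, 'b) monoid_scheme \<Rightarrow> bool" where
  "metabelian G \<longleftrightarrow> comm_group (G\<lparr>carrier := derived G (carrier G)\<rparr>)"

end

theory Submission
  imports Defs
begin

text \<open>Fix a word \<open>w\<close> and values of \<open>x\<^sub>2, \<dots>, x\<^sub>n\<close>, and let \<open>\<phi>(g) = w(g, x\<^sub>2, \<dots>, x\<^sub>n)\<close>.  On the
  abelianization \<open>\<phi>\<close> is \<open>a \<mapsto> a\<^sup>k b\<close>, and on the derived subgroup, a module over the group ring of the
  abelianization, it is \<open>m \<mapsto> r(m) c\<close> with \<open>r\<close> in this commutative ring.  Both modules are Noetherian.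
  If all orbits of such an affine map hit 1, then 1 is periodic, and its orbit consists of fixed points
  of a power of \<open>r\<close>; hence some power of \<open>r\<close> has finite image.  Noetherian induction bounds, uniformly
  in \<open>r\<close>, an exponent for which the image is finite and the size of this image, and this bounds the
  time after which 1 is hit.\<close>

section \<open>Noetherian groups with operators\<close>

text \<open>The words form an infinite set, in any number of variables, so the bound may depend
  neither on \<open>r\<close> nor on the constant of the affine map. All that the words share is the
  set of possible linear parts: integer powers on the abelianization and \<open>ring_ops\<close> on
  the derived subgroup. The derived subgroup need not be finitely generated as a group, but it is as
  a module, by the commutators of the generators; conjugations by the generators and their inverses
  are finitely many commuting operators on it, so Hilbert's basis theorem applies. The group ring
  itself is not built: operators are plain functions, and statements about a quotient module are
  phrased through the subgroup \<open>N\<close>. Hitting 1 in the abelianization puts one iterate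
  into the derived subgroup; to continue there, the later iterates must not leave it, which takes a
  separate argument.\<close>

definition op_subgroup :: "('a, 'b) monoid_scheme \<Rightarrow> ('a \<Rightarrow> 'a) set \<Rightarrow> 'a set \<Rightarrow> bool" where
  "op_subgroup G \<Omega> N \<longleftrightarrow> subgroup N G \<and> (\<forall>r\<in>\<Omega>. \<forall>x\<in>N. r x \<in> N)"

text \<open>The ambient group stays fixed while \<open>K\<close> grows, so generators and operators
  can be adjoined one at a time without changing the group.\<close>

definition op_noetherian :: "('a, 'b) monoid_scheme \<Rightarrow> ('a \<Rightarrow> 'a) set \<Rightarrow> 'a set \<Rightarrow> bool" where
  "op_noetherian G \<Omega> K \<longleftrightarrow>
     (\<forall>f :: nat \<Rightarrow> 'a set. (\<forall>i. op_subgroup G \<Omega> (f i) \<and> f i \<subseteq> K \<and> f i \<subseteq> f (Suc i)) \<longrightarrow>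
        (\<exists>n. \<forall>m\<ge>n. f m = f n))"

lemma op_noetherianD:
  assumes "op_noetherian G \<Omega> K" "\<And>i. op_subgroup G \<Omega> (f i)" "\<And>i. f i \<subseteq> K" "\<And>i. f i \<subseteq> f (Suc i)"
  obtains n where "\<And>m. m \<ge> n \<Longrightarrow> f m = f n"
  using assms unfolding op_noetherian_def by metis

text \<open>More operators leave fewer invariant subgroups, hence fewer chains. This lets
  conjugation by finitely many generators stand for all of \<open>ring_ops\<close>.\<close>

lemma op_noetherian_mono_ops:
  assumes "op_noetherian G \<Omega> K"
    and "\<And>N. N \<subseteq> K \<Longrightarrow> op_subgroup G \<Omega>' N \<Longrightarrow> op_subgroup G \<Omega> N"
  shows "op_noetherian G \<Omega>' K"
  using assms unfolding op_noetherian_def by meson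

text \<open>An infinite descending chain for \<open>r\<close> would be a strictly ascending chain of
  subgroups of \<open>K\<close>; so the hypothesis is available for all strictly larger
  subgroups.\<close>

lemma op_noetherian_induct [consumes 3, case_names step]:
  assumes noeth: "op_noetherian G \<Omega> K" and N: "op_subgroup G \<Omega> N" "N \<subseteq> K"
    and step: "\<And>N. op_subgroup G \<Omega> N \<Longrightarrow> N \<subseteq> K \<Longrightarrow>
      (\<And>N'. op_subgroup G \<Omega> N' \<Longrightarrow> N' \<subseteq> K \<Longrightarrow> N \<subset> N' \<Longrightarrow> P N') \<Longrightarrow> P N"
  shows "P N"
proof -
  define r where "r = {(N', N). op_subgroup G \<Omega> N' \<and> N' \<subseteq> K \<and> op_subgroup G \<Omega> N \<and> N \<subseteq> K \<and> N \<subset> N'}"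
  have "wf r"
    unfolding wf_iff_no_infinite_down_chain
  proof
    assume "\<exists>f. \<forall>i. (f (Suc i), f i) \<in> r"
    then obtain f where f: "\<And>i. (f (Suc i), f i) \<in> r" by blast
    obtain n where "\<And>m. m \<ge> n \<Longrightarrow> f m = f n"
      by (rule op_noetherianD[OF noeth, of f]) (use f in \<open>auto simp: r_def\<close>)
    then have "f (Suc n) = f n" using le_SucI by blast
    with f[of n] show False by (auto simp: r_def)
  qed
  then show ?thesis using N
  proof (induction N rule: wf_induct_rule)
    case (less N)
    show ?case
      by (rule step) (use less in \<open>auto simp: r_def\<close>)
  qed
qed

text \<open>Division with remainder: the least positive integer \<open>d\<close> that occurs
  anywhere in the chain divides every element of every member, so the chain stops growing at the
  first member known to contain \<open>d\<close>.\<close>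

lemma int_subgroup_chain_stabilizes:
  fixes L :: "nat \<Rightarrow> int set"
  assumes zero: "\<And>i. 0 \<in> L i"
    and diff: "\<And>i x y. x \<in> L i \<Longrightarrow> y \<in> L i \<Longrightarrow> x - y \<in> L i"
    and chain: "\<And>i. L i \<subseteq> L (Suc i)"
  obtains n where "\<And>m. m \<ge> n \<Longrightarrow> L m = L n"
proof -
  have mono: "i \<le> j \<Longrightarrow> L i \<subseteq> L j" for i j
    by (rule lift_Suc_mono_le) (use chain in auto)
  have neg: "x \<in> L i \<Longrightarrow> - x \<in> L i" for x i using diff[OF zero, of x i] by simp
  have add: "x \<in> L i \<Longrightarrow> y \<in> L i \<Longrightarrow> x + y \<in> L i" for x y i using diff[OF _ neg, of x i y] by simp
  have natmul: "x \<in> L i \<Longrightarrow> int k * x \<in> L i" for x i k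
    by (induction k) (auto simp: zero add algebra_simps)
  have mult: "x \<in> L i \<Longrightarrow> k * x \<in> L i" for x i k
    using natmul[of x i "nat k"] neg[OF natmul[of x i "nat (- k)"]] by (cases "k \<ge> 0") auto
  show thesis
  proof (cases "\<exists>k i. 0 < k \<and> int k \<in> L i")
    case False
    have "L m = {0}" for m
    proof -
      have "x = 0" if x: "x \<in> L m" for x
      proof (rule ccontr)
        assume "x \<noteq> 0"
        then have "0 < nat \<bar>x\<bar> \<and> int (nat \<bar>x\<bar>) \<in> L m" using x neg[OF x] by (auto simp: abs_if)
        with False show False by blast
      qed
      with zero show ?thesis by blast
    qed
    then show ?thesis using that by blast
  next
    case True
    define d where "d = (LEAST k. \<exists>i. 0 < k \<and> int k \<in> L i)"
    have "\<exists>i. 0 < d \<and> int d \<in> L i" unfolding d_def by (rule LeastI_ex) (use True in blast)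
    then obtain n where d: "0 < d" "int d \<in> L n" by blast
    have "L m \<subseteq> L n" if "m \<ge> n" for m
    proof
      fix x assume x: "x \<in> L m"
      have dm: "int d \<in> L m" using d mono[OF that] by blast
      have "x mod int d \<in> L m"
        using diff[OF x mult[OF dm, of "x div int d"]] by (simp add: minus_div_mult_eq_mod)
      moreover have "nat (x mod int d) < d" using d by (simp add: nat_less_iff)
      ultimately have "\<not> 0 < x mod int d"
        using not_less_Least[of "nat (x mod int d)" "\<lambda>k. \<exists>i. 0 < k \<and> int k \<in> L i"]
        unfolding d_def[symmetric] by auto
      then have "x mod int d = 0" using d pos_mod_sign[of "int d" x] by linarith
      then have "x = (x div int d) * int d" by (metis add.right_neutral div_mult_mod_eq)
      then show "x \<in> L n" using mult[OF d(2)] by metis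
    qed
    with mono that show ?thesis by blast
  qed
qed

lemma (in group) op_subgroupD:
  assumes "op_subgroup G \<Omega> N"
  shows "subgroup N G" "N \<subseteq> carrier G" "\<one> \<in> N"
    "\<And>x y. x \<in> N \<Longrightarrow> y \<in> N \<Longrightarrow> x \<otimes> y \<in> N" "\<And>x. x \<in> N \<Longrightarrow> inv x \<in> N"
    "\<And>r x. r \<in> \<Omega> \<Longrightarrow> x \<in> N \<Longrightarrow> r x \<in> N"
  using assms by (auto simp: op_subgroup_def subgroup_def)

lemma hom_funpow: "r \<in> hom G G \<Longrightarrow> (r ^^ k) \<in> hom G G"
  by (induction k) (auto simp: hom_def Pi_iff)

section \<open>From finite generation to the Noetherian property\<close>

context comm_group
begin

lemma mult_cancel_quotient:
  assumes "a \<in> carrier G" "b \<in> carrier G" "c \<in> carrier G"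
  shows "a \<otimes> c \<otimes> inv (b \<otimes> c) = a \<otimes> inv b"
proof -
  have "a \<otimes> c \<otimes> inv (b \<otimes> c) = a \<otimes> inv b \<otimes> (c \<otimes> inv c)"
    using assms by (simp add: inv_mult m_ac del: r_inv)
  with assms show ?thesis by simp
qed

text \<open>A subgroup in the chain is controlled by its intersection with \<open>K\<close> and by
  the set of exponents of \<open>y\<close> in its elements, a subgroup of the integers. Once both
  are stable, so is the chain.\<close>

lemma noetherian_adjoin_element:
  assumes K: "subgroup K G" "op_noetherian G {} K" and y: "y \<in> carrier G"
  obtains K' where "subgroup K' G" "K \<subseteq> K'" "y \<in> K'" "op_noetherian G {} K'"
proof
  interpret K: subgroup K G by fact
  define K' where "K' = {h \<otimes> y [^] z | h (z :: int). h \<in> K}"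
  show "subgroup K' G"
  proof (rule subgroupI)
    show "K' \<subseteq> carrier G" using y by (auto simp: K'_def)
    show "K' \<noteq> {}" using K.one_closed unfolding K'_def by blast
  next
    fix a assume "a \<in> K'"
    then obtain h z where a: "a = h \<otimes> y [^] (z :: int)" "h \<in> K" by (auto simp: K'_def)
    then have "inv a = inv h \<otimes> y [^] (- z)" using y by (simp add: inv_mult int_pow_neg)
    moreover have "inv h \<in> K" using a by simp
    ultimately show "inv a \<in> K'" unfolding K'_def by blast
  next
    fix a b assume "a \<in> K'" "b \<in> K'"
    then obtain h z k u where a: "a = h \<otimes> y [^] (z :: int)" "h \<in> K"
      and b: "b = k \<otimes> y [^] (u :: int)" "k \<in> K" by (auto simp: K'_def)
    then have "a \<otimes> b = (h \<otimes> k) \<otimes> y [^] (z + u)" using y by (simp add: int_pow_mult m_ac)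
    moreover have "h \<otimes> k \<in> K" using a b by simp
    ultimately show "a \<otimes> b \<in> K'" unfolding K'_def by blast
  qed
  show "K \<subseteq> K'"
  proof
    fix h assume "h \<in> K"
    then have "h = h \<otimes> y [^] (0 :: int)" using y by simp
    with \<open>h \<in> K\<close> show "h \<in> K'" unfolding K'_def by blast
  qed
  have "y = \<one> \<otimes> y [^] (1 :: int)" using y by simp
  then show "y \<in> K'" unfolding K'_def using K.one_closed by blast
  show "op_noetherian G {} K'"
    unfolding op_noetherian_def
  proof (intro allI impI)
    fix f :: "nat \<Rightarrow> 'a set"
    assume f: "\<forall>i. op_subgroup G {} (f i) \<and> f i \<subseteq> K' \<and> f i \<subseteq> f (Suc i)"
    have sub: "subgroup (f i) G" for i using f by (auto simp: op_subgroup_def)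
    have fmono: "i \<le> j \<Longrightarrow> f i \<subseteq> f j" for i j by (rule lift_Suc_mono_le) (use f in auto)
    define L where "L i = {z :: int. \<exists>h\<in>K. h \<otimes> y [^] z \<in> f i}" for i
    obtain n where n: "\<And>m. m \<ge> n \<Longrightarrow> L m = L n"
    proof (rule int_subgroup_chain_stabilizes[of L])
      show "0 \<in> L i" for i
        using subgroup.one_closed[OF sub[of i]] K.one_closed y by (force simp: L_def)
      show "L i \<subseteq> L (Suc i)" for i using f by (fastforce simp: L_def)
      fix i z u assume "z \<in> L i" "u \<in> L i"
      then obtain h k where hk: "h \<in> K" "k \<in> K" "h \<otimes> y [^] z \<in> f i" "k \<otimes> y [^] u \<in> f i"
        unfolding L_def by blast
      have "h \<otimes> y [^] z \<otimes> inv (k \<otimes> y [^] u) = (h \<otimes> inv k) \<otimes> y [^] (z - u)"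
        using y hk by (simp add: inv_mult int_pow_diff m_ac)
      then have "(h \<otimes> inv k) \<otimes> y [^] (z - u) \<in> f i"
        using hk subgroup.m_closed[OF sub] subgroup.m_inv_closed[OF sub] by metis
      moreover have "h \<otimes> inv k \<in> K" using hk by simp
      ultimately show "z - u \<in> L i" unfolding L_def by blast
    qed blast
    obtain n' where n': "\<And>m. m \<ge> n' \<Longrightarrow> f m \<inter> K = f n' \<inter> K"
      by (rule op_noetherianD[OF K(2), of "\<lambda>i. f i \<inter> K"])
        (use f sub K.subgroup_axioms subgroups_Inter_pair in \<open>auto simp: op_subgroup_def\<close>)
    show "\<exists>n. \<forall>m\<ge>n. f m = f n"
    proof (intro exI allI impI)
      fix m assume m: "m \<ge> max n n'"
      have "f m \<subseteq> f (max n n')"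
      proof
        fix a assume a: "a \<in> f m"
        then obtain h z where hz: "a = h \<otimes> y [^] (z :: int)" "h \<in> K"
          using f unfolding K'_def by blast
        then have "z \<in> L m" using a unfolding L_def by blast
        then have "z \<in> L (max n n')" using n m by (metis max.bounded_iff max.cobounded1)
        then obtain k where k: "k \<in> K" "k \<otimes> y [^] z \<in> f (max n n')" unfolding L_def by blast
        \<comment> \<open>Both elements carry the same power of \<open>y\<close>, so their quotient
          lies in \<open>K\<close>, where the chain is already stable.\<close>
        have "a \<otimes> inv (k \<otimes> y [^] z) = h \<otimes> inv k"
          using mult_cancel_quotient[of h k "y [^] z"] y hz k by simp
        moreover have "a \<otimes> inv (k \<otimes> y [^] z) \<in> f m"
          using a k fmono[OF m] subgroup.m_closed[OF sub] subgroup.m_inv_closed[OF sub] by blast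
        ultimately have "h \<otimes> inv k \<in> f m \<inter> K" using hz k by simp
        then have "h \<otimes> inv k \<in> f (max n n')" using n' m by (metis Int_iff max.bounded_iff max.cobounded2)
        then have "(h \<otimes> inv k) \<otimes> (k \<otimes> y [^] z) \<in> f (max n n')"
          using k subgroup.m_closed[OF sub] by blast
        moreover have "(h \<otimes> inv k) \<otimes> (k \<otimes> y [^] z) = a"
          using inv_solve_right[of "h \<otimes> inv k" a "k \<otimes> y [^] z"]
            mult_cancel_quotient[of h k "y [^] z"] y hz k by simp
        ultimately show "a \<in> f (max n n')" by simp
      qed
      with fmono[OF m] show "f m = f (max n n')" by blast
    qed
  qed
qed

lemma noetherian_finite_subset:
  assumes "finite Y" "Y \<subseteq> carrier G"
  obtains K where "subgroup K G" "Y \<subseteq> K" "op_noetherian G {} K"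
  using assms
proof (induction Y arbitrary: thesis rule: finite_induct)
  case empty
  have "op_noetherian G {} {\<one>}"
    unfolding op_noetherian_def op_subgroup_def
    by (metis subgroup.one_closed empty_iff insert_iff subset_singleton_iff)
  then show ?case using empty triv_subgroup by blast
next
  case (insert y Y)
  then obtain K where "subgroup K G" "Y \<subseteq> K" "op_noetherian G {} K" by blast
  moreover obtain K' where "subgroup K' G" "K \<subseteq> K'" "y \<in> K'" "op_noetherian G {} K'"
    using noetherian_adjoin_element[of K y] calculation insert.prems by auto
  ultimately show ?case using insert.prems(1)[of K'] by auto
qed

text \<open>Polynomials in \<open>t\<close> of degree less than \<open>k\<close> with coefficients
  in \<open>K\<close>. The recursion splits off the leading coefficient, which is the one that
  Hilbert's argument compares.\<close>

fun horner :: "('a \<Rightarrow> 'a) \<Rightarrow> 'a set \<Rightarrow> nat \<Rightarrow> 'a set" where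
  "horner t K 0 = {\<one>}"
| "horner t K (Suc k) = {p \<otimes> (t ^^ k) h | p h. p \<in> horner t K k \<and> h \<in> K}"

text \<open>This is how commutativity of the ring enters: it makes the kernel and the image of one
  operator invariant under all the others.\<close>

definition commuting_ops :: "('a \<Rightarrow> 'a) set \<Rightarrow> bool" where
  "commuting_ops R \<longleftrightarrow>
     R \<subseteq> hom G G \<and> (\<forall>r\<in>R. \<forall>s\<in>R. \<forall>x\<in>carrier G. r (s x) = s (r x))"

lemma commuting_opsD:
  assumes "commuting_ops R"
  shows "R \<subseteq> hom G G" "r \<in> R \<Longrightarrow> s \<in> R \<Longrightarrow> x \<in> carrier G \<Longrightarrow> r (s x) = s (r x)"
  using assms by (auto simp: commuting_ops_def)

text \<open>The sum of a submodule and an image under \<open>t\<close>. It serves both for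
  polynomials of bounded degree, with a power of the adjoined operator as \<open>t\<close>, and for
  the image of an operator modulo a submodule.\<close>

lemma op_subgroup_products:
  assumes P: "op_subgroup G \<Omega> P" and K: "op_subgroup G \<Omega> K"
    and \<Omega>: "\<Omega> \<subseteq> hom G G" and t: "t \<in> hom G G"
    and comm: "\<And>r x. r \<in> \<Omega> \<Longrightarrow> x \<in> carrier G \<Longrightarrow> r (t x) = t (r x)"
  shows "op_subgroup G \<Omega> {p \<otimes> t h | p h. p \<in> P \<and> h \<in> K}" (is "op_subgroup G \<Omega> ?Q")
  unfolding op_subgroup_def
proof (intro conjI ballI)
  interpret t: group_hom G G t by unfold_locales (fact t)
  note P = op_subgroupD[OF P] and K = op_subgroupD[OF K]
  note car = subsetD[OF P(2)] subsetD[OF K(2)]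
  show "subgroup ?Q G"
  proof (rule subgroupI)
    show "?Q \<subseteq> carrier G" using car by auto
    show "?Q \<noteq> {}" using P(3) K(3) by blast
  next
    fix a assume "a \<in> ?Q"
    then obtain p h where a: "a = p \<otimes> t h" "p \<in> P" "h \<in> K" by blast
    then have "inv a = inv p \<otimes> t (inv h)" using car by (simp add: inv_mult)
    moreover have "inv p \<in> P" "inv h \<in> K" using a P(5) K(5) by auto
    ultimately show "inv a \<in> ?Q" by blast
  next
    fix a b assume "a \<in> ?Q" "b \<in> ?Q"
    then obtain p h q k where a: "a = p \<otimes> t h" "p \<in> P" "h \<in> K"
      and b: "b = q \<otimes> t k" "q \<in> P" "k \<in> K" by blast
    then have "a \<otimes> b = (p \<otimes> q) \<otimes> t (h \<otimes> k)" using car by (simp add: m_ac)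
    moreover have "p \<otimes> q \<in> P" "h \<otimes> k \<in> K" using a b P(4) K(4) by auto
    ultimately show "a \<otimes> b \<in> ?Q" by blast
  qed
  fix r a assume r: "r \<in> \<Omega>" and "a \<in> ?Q"
  then obtain p h where a: "a = p \<otimes> t h" "p \<in> P" "h \<in> K" by blast
  interpret r: group_hom G G r by unfold_locales (use r \<Omega> in blast)
  have "r a = r p \<otimes> t (r h)" using a car comm[OF r] by simp
  moreover have "r p \<in> P" "r h \<in> K" using a r P(6) K(6) by auto
  ultimately show "r a \<in> ?Q" by blast
qed

lemma funpow_commute:
  assumes "t \<in> hom G G" "r \<in> hom G G" "\<And>x. x \<in> carrier G \<Longrightarrow> r (t x) = t (r x)" "x \<in> carrier G"
  shows "r ((t ^^ k) x) = (t ^^ k) (r x)"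
proof -
  have "(t ^^ k) x \<in> carrier G" for k using hom_funpow[OF assms(1)] assms(4) by (auto simp: hom_def)
  then show ?thesis by (induction k) (use assms in auto)
qed

text \<open>Hilbert's basis argument: the coefficients of \<open>t ^^ k\<close> in the elements of \<open>N\<close> of degree
  at most \<open>k\<close> form an \<open>\<Omega>\<close>-subgroup of \<open>K\<close>, which grows with \<open>k\<close> and with \<open>N\<close>.\<close>

lemma noetherian_adjoin_operator:
  assumes K: "op_subgroup G \<Omega> K" "op_noetherian G \<Omega> K"
    and \<Omega>: "\<Omega> \<subseteq> hom G G" and t: "t \<in> hom G G"
    and comm: "\<And>r x. r \<in> \<Omega> \<Longrightarrow> x \<in> carrier G \<Longrightarrow> r (t x) = t (r x)"
  obtains K' where "op_subgroup G (insert t \<Omega>) K'" "K \<subseteq> K'" "op_noetherian G (insert t \<Omega>) K'"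
proof
  define Q where "Q = horner t K"
  define K' where "K' = (\<Union>k. Q k)"
  have Q_Suc: "Q (Suc k) = {p \<otimes> (t ^^ k) h | p h. p \<in> Q k \<and> h \<in> K}" for k by (simp add: Q_def)
  interpret t: group_hom G G t by unfold_locales (fact t)
  have tk: "group_hom G G (t ^^ k)" for k
    by unfold_locales (rule hom_funpow[OF t])
  have comm_k: "r ((t ^^ k) x) = (t ^^ k) (r x)" if "r \<in> \<Omega>" "x \<in> carrier G" for r x k
    using funpow_commute t \<Omega> comm that by blast
  note K' = op_subgroupD[OF K(1)]
  have Q: "op_subgroup G \<Omega> (Q k)" for k
  proof (induction k)
    case 0
    have "r \<one> = \<one>" if "r \<in> \<Omega>" for r
      using \<Omega> that hom_one[of r G G] by blast
    then show ?case using triv_subgroup by (simp add: Q_def op_subgroup_def)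
  next
    case (Suc k)
    show ?case unfolding Q_Suc
      by (rule op_subgroup_products[OF Suc K(1) \<Omega> hom_funpow[OF t] comm_k])
  qed
  note QD = op_subgroupD[OF Q]
  have Q_inc: "Q k \<subseteq> Q (Suc k)" for k
  proof
    fix p assume p: "p \<in> Q k"
    have "p = p \<otimes> (t ^^ k) \<one>" using subsetD[OF QD(2) p] group_hom.hom_one[OF tk] by simp
    then show "p \<in> Q (Suc k)" using p K'(3) unfolding Q_Suc by blast
  qed
  have Q_mono: "i \<le> j \<Longrightarrow> Q i \<subseteq> Q j" for i j by (rule lift_Suc_mono_le) (use Q_inc in auto)
  have t_Q: "p \<in> Q k \<Longrightarrow> t p \<in> Q (Suc k)" for p k
  proof (induction k arbitrary: p)
    case 0
    then have "t p = p" by (simp add: Q_def)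
    then show ?case using 0 Q_inc by auto
  next
    case (Suc k)
    then obtain q h where p: "p = q \<otimes> (t ^^ k) h" "q \<in> Q k" "h \<in> K" unfolding Q_Suc by blast
    have "t p = t q \<otimes> (t ^^ Suc k) h"
      using p subsetD[OF QD(2) p(2)] subsetD[OF K'(2) p(3)] group_hom.hom_closed[OF tk] by simp
    with Suc.IH[OF p(2)] p(3) show ?case unfolding Q_Suc[of "Suc k"] by blast
  qed
  show "op_subgroup G (insert t \<Omega>) K'"
    unfolding op_subgroup_def
  proof (intro conjI ballI)
    show "subgroup K' G"
    proof (rule subgroupI)
      show "K' \<subseteq> carrier G" using QD(2) by (auto simp: K'_def)
      show "K' \<noteq> {}" using QD(3) by (auto simp: K'_def)
      show "inv a \<in> K'" if "a \<in> K'" for a using that QD(5) by (auto simp: K'_def)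
      show "a \<otimes> b \<in> K'" if ab: "a \<in> K'" "b \<in> K'" for a b
      proof -
        obtain i j where "a \<in> Q i" "b \<in> Q j" using ab by (auto simp: K'_def)
        then have "a \<in> Q (max i j)" "b \<in> Q (max i j)" using Q_mono[of i "max i j"] Q_mono[of j "max i j"] by auto
        then show ?thesis using QD(4) by (auto simp: K'_def)
      qed
    qed
    show "r x \<in> K'" if "r \<in> insert t \<Omega>" "x \<in> K'" for r x
      using that t_Q QD(6) unfolding K'_def by blast
  qed
  have "h \<in> Q 1" if "h \<in> K" for h
  proof -
    have "h = \<one> \<otimes> (t ^^ 0) h" using that K'(2) by auto
    then show ?thesis using that QD(3) unfolding One_nat_def Q_Suc by blast
  qed
  then show "K \<subseteq> K'" by (auto simp: K'_def)
  show "op_noetherian G (insert t \<Omega>) K'"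
    unfolding op_noetherian_def
  proof (intro allI impI)
    fix f :: "nat \<Rightarrow> 'a set"
    assume f: "\<forall>i. op_subgroup G (insert t \<Omega>) (f i) \<and> f i \<subseteq> K' \<and> f i \<subseteq> f (Suc i)"
    have op: "op_subgroup G (insert t \<Omega>) (f i)" for i using f by auto
    note fD = op_subgroupD[OF op]
    have fmono: "i \<le> j \<Longrightarrow> f i \<subseteq> f j" for i j by (rule lift_Suc_mono_le) (use f in auto)
    define L where "L k i = {h \<in> K. \<exists>p\<in>Q k. p \<otimes> (t ^^ k) h \<in> f i}" for k i
    have L_op: "op_subgroup G \<Omega> (L k i)" for k i
      unfolding op_subgroup_def
    proof (intro conjI ballI)
      interpret tk: group_hom G G "t ^^ k" by (rule tk)
      show "subgroup (L k i) G"
      proof (rule subgroupI)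
        show "L k i \<subseteq> carrier G" using K'(2) by (auto simp: L_def)
        have "\<one> \<in> L k i" using fD(3) K'(3) QD(3) by (force simp: L_def)
        then show "L k i \<noteq> {}" by blast
      next
        fix a assume "a \<in> L k i"
        then obtain p where p: "a \<in> K" "p \<in> Q k" "p \<otimes> (t ^^ k) a \<in> f i" by (auto simp: L_def)
        have "inv (p \<otimes> (t ^^ k) a) = inv p \<otimes> (t ^^ k) (inv a)"
          using p QD(2) K'(2) by (simp add: inv_mult subset_iff)
        then have "inv p \<otimes> (t ^^ k) (inv a) \<in> f i" using fD(5) p by metis
        then show "inv a \<in> L k i" using p QD(5) K'(5) unfolding L_def by blast
      next
        fix a b assume "a \<in> L k i" "b \<in> L k i"
        then obtain p q where p: "a \<in> K" "p \<in> Q k" "p \<otimes> (t ^^ k) a \<in> f i"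
          and q: "b \<in> K" "q \<in> Q k" "q \<otimes> (t ^^ k) b \<in> f i" by (auto simp: L_def)
        have "(p \<otimes> (t ^^ k) a) \<otimes> (q \<otimes> (t ^^ k) b) = (p \<otimes> q) \<otimes> (t ^^ k) (a \<otimes> b)"
          using subsetD[OF QD(2) p(2)] subsetD[OF QD(2) q(2)] subsetD[OF K'(2) p(1)]
            subsetD[OF K'(2) q(1)] by (simp add: m_ac)
        then have "(p \<otimes> q) \<otimes> (t ^^ k) (a \<otimes> b) \<in> f i" using fD(4) p q by metis
        then show "a \<otimes> b \<in> L k i" using p q QD(4) K'(4) unfolding L_def by blast
      qed
      fix r a assume r: "r \<in> \<Omega>" and "a \<in> L k i"
      then obtain p where p: "a \<in> K" "p \<in> Q k" "p \<otimes> (t ^^ k) a \<in> f i" by (auto simp: L_def)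
      interpret r: group_hom G G r by unfold_locales (use r \<Omega> in blast)
      have "r (p \<otimes> (t ^^ k) a) = r p \<otimes> (t ^^ k) (r a)"
        using subsetD[OF QD(2) p(2)] subsetD[OF K'(2) p(1)] comm_k[OF r] by simp
      then have "r p \<otimes> (t ^^ k) (r a) \<in> f i" using fD(6) r p by (metis insertI2)
      then show "r a \<in> L k i" using p QD(6) K'(6) r unfolding L_def by blast
    qed
    have L_K: "L k i \<subseteq> K" for k i by (auto simp: L_def)
    have L_i: "L k i \<subseteq> L k j" if "i \<le> j" for k i j using fmono[OF that] by (auto simp: L_def)
    have "L k i \<subseteq> L (Suc k) i" for k i
    proof
      interpret tk: group_hom G G "t ^^ k" by (rule tk)
      fix a assume "a \<in> L k i"
      then obtain p where p: "a \<in> K" "p \<in> Q k" "p \<otimes> (t ^^ k) a \<in> f i" by (auto simp: L_def)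
      have "t (p \<otimes> (t ^^ k) a) = t p \<otimes> (t ^^ Suc k) a"
        using subsetD[OF QD(2) p(2)] subsetD[OF K'(2) p(1)] by simp
      then have "t p \<otimes> (t ^^ Suc k) a \<in> f i" using fD(6) p by (metis insertI1)
      then show "a \<in> L (Suc k) i" using p t_Q unfolding L_def by blast
    qed
    then have L_k: "k \<le> l \<Longrightarrow> L k i \<subseteq> L l i" for k l i by (rule lift_Suc_mono_le)
    \<comment> \<open>The diagonal chain settles all degrees above \<open>d\<close> at once; the
      finitely many remaining degrees are settled one by one through \<open>e\<close>.\<close>
    obtain d where d: "\<And>m. m \<ge> d \<Longrightarrow> L m m = L d d"
    proof (rule op_noetherianD[OF K(2), of "\<lambda>i. L i i"])
      show "L i i \<subseteq> L (Suc i) (Suc i)" for i using L_i[of i "Suc i" i] L_k[of i "Suc i" "Suc i"] by auto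
    qed (use L_op L_K in auto)
    have "\<exists>e. \<forall>i\<ge>e. L k i = L k e" for k
      by (rule op_noetherianD[OF K(2), of "L k"]) (use L_op L_K L_i in \<open>auto 4 3\<close>)
    then obtain e where e: "\<And>k i. i \<ge> e k \<Longrightarrow> L k i = L k (e k)" by metis
    define J where "J = Max (insert d (e ` {..d}))"
    have J: "d \<le> J" "k \<le> d \<Longrightarrow> e k \<le> J" for k unfolding J_def by (rule Max_ge; simp)+
    have L_stable: "L k i = L k J" if i: "J \<le> i" for k i
    proof (cases "k \<le> d")
      case True
      then have "e k \<le> J" by (rule J(2))
      then show ?thesis using e[of k i] e[of k J] i by (metis order.trans)
    next
      case False
      \<comment> \<open>For degrees above \<open>d\<close>, \<open>L k i\<close> is squeezed between
        two places where the diagonal value \<open>L d d\<close> is known.\<close>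
      have "L k i \<subseteq> L (max k i) (max k i)" using L_k[of k "max k i" i] L_i[of i "max k i" "max k i"] by auto
      also have "\<dots> = L d d" using d[of "max k i"] False by simp
      also have "\<dots> \<subseteq> L k J" using L_k[of d k d] L_i[of d J k] J False by auto
      finally show ?thesis using L_i[OF i] by blast
    qed
    show "\<exists>n. \<forall>m\<ge>n. f m = f n"
    proof (intro exI allI impI)
      fix i assume i: "J \<le> i"
      have "a \<in> f J" if "a \<in> f i" "a \<in> Q k" for a k
        using that
      proof (induction k arbitrary: a)
        case 0
        then show ?case using fD(3) by (simp add: Q_def)
      next
        case (Suc k)
        interpret tk: group_hom G G "t ^^ k" by (rule tk)
        obtain p h where a: "a = p \<otimes> (t ^^ k) h" "p \<in> Q k" "h \<in> K" using Suc.prems unfolding Q_Suc by blast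
        then have "h \<in> L k i" using Suc.prems unfolding L_def by blast
        then obtain q where q: "q \<in> Q k" "q \<otimes> (t ^^ k) h \<in> f J" using L_stable[OF i] unfolding L_def by blast
        have car: "p \<in> carrier G" "q \<in> carrier G" "(t ^^ k) h \<in> carrier G"
          using a q QD(2) K'(2) by (blast intro: tk.hom_closed)+
        have "a \<otimes> inv (q \<otimes> (t ^^ k) h) \<in> f i"
          using Suc.prems(1) q(2) fmono[OF i] fD(4,5) by blast
        then have "p \<otimes> inv q \<in> f i" using a mult_cancel_quotient car by simp
        then have "p \<otimes> inv q \<in> f J" using Suc.IH a(2) q(1) QD(4,5) by blast
        then have "p \<otimes> inv q \<otimes> (q \<otimes> (t ^^ k) h) \<in> f J" using q(2) fD(4) by blast
        moreover have "p \<otimes> inv q \<otimes> (q \<otimes> (t ^^ k) h) = a"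
          using inv_solve_right[of "p \<otimes> inv q" a "q \<otimes> (t ^^ k) h"] mult_cancel_quotient[of p q "(t ^^ k) h"] car a
          by simp
        ultimately show ?case by simp
      qed
      then have "f i \<subseteq> f J" using f unfolding K'_def by blast
      with fmono[OF i] show "f i = f J" by blast
    qed
  qed
qed

text \<open>Hilbert's basis theorem for modules over the integer polynomials in finitely many
  commuting operators, by adjoining the operators one after another.\<close>

lemma noetherian_finite_operators:
  assumes "finite \<Omega>" "commuting_ops \<Omega>" and Y: "finite Y" "Y \<subseteq> carrier G"
  obtains K where "op_subgroup G \<Omega> K" "Y \<subseteq> K" "op_noetherian G \<Omega> K"
  using assms(1,2)
proof (induction \<Omega> arbitrary: thesis rule: finite_induct)
  case empty
  then show ?case using noetherian_finite_subset[OF Y] by (auto simp: op_subgroup_def)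
next
  case (insert t \<Omega>)
  obtain K where K: "op_subgroup G \<Omega> K" "Y \<subseteq> K" "op_noetherian G \<Omega> K"
    using insert.IH insert.prems(2) by (auto simp: commuting_ops_def)
  obtain K' where "op_subgroup G (insert t \<Omega>) K'" "K \<subseteq> K'" "op_noetherian G (insert t \<Omega>) K'"
    by (rule noetherian_adjoin_operator[OF K(1,3), of t]) (use insert.prems(2) in \<open>auto simp: commuting_ops_def\<close>)
  then show ?case using insert.prems(1)[of K'] K(2) by auto
qed

end

section \<open>Affine maps\<close>

context comm_group
begin

text \<open>The kernel and the image of \<open>\<mu>\<close> on the quotient by \<open>N\<close>,
  pulled back to the whole group.\<close>

lemma op_subgroup_preimage_image:
  assumes ops: "commuting_ops R"
    and N: "op_subgroup G R N" and \<mu>: "\<mu> \<in> R"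
  shows "op_subgroup G R {x \<in> carrier G. \<mu> x \<in> N}" (is "op_subgroup G R ?N1")
    and "op_subgroup G R {n \<otimes> \<mu> x | n x. n \<in> N \<and> x \<in> carrier G}"
proof -
  note R = commuting_opsD(1)[OF ops] and comm = commuting_opsD(2)[OF ops]
  interpret \<mu>: group_hom G G \<mu> by unfold_locales (use \<mu> R in blast)
  note ND = op_subgroupD[OF N]
  have R_closed: "r x \<in> carrier G" if "r \<in> R" "x \<in> carrier G" for r x
    using R that by (auto simp: hom_def)
  show "op_subgroup G R ?N1"
    unfolding op_subgroup_def
  proof (intro conjI ballI)
    show "subgroup ?N1 G" using ND(3,4,5) by unfold_locales auto
    show "r x \<in> ?N1" if "r \<in> R" "x \<in> ?N1" for r x
      using that R_closed comm[OF \<mu>, of r x] ND(6) by auto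
  qed
  have "op_subgroup G R (carrier G)" using R_closed by (auto simp: op_subgroup_def subgroup_self)
  then show "op_subgroup G R {n \<otimes> \<mu> x | n x. n \<in> N \<and> x \<in> carrier G}"
    by (rule op_subgroup_products[OF N _ R]) (use \<mu> R comm in auto)
qed

text \<open>For a finite \<open>Y\<close> and a subgroup \<open>N\<close> this says that
  \<open>A\<close> meets at most \<open>card Y\<close> cosets of \<open>N\<close>, without forming
  the quotient.\<close>

definition covered_by :: "'a set \<Rightarrow> 'a set \<Rightarrow> 'a set \<Rightarrow> bool" where
  "covered_by A Y N \<longleftrightarrow> (\<forall>x\<in>A. \<exists>y\<in>Y. \<exists>n\<in>N. x = y \<otimes> n)"

text \<open>Noetherian induction on \<open>N\<close>.  If some \<open>\<mu>\<close> has both a kernel and a proper nonzero image on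
  the quotient by \<open>N\<close>, combine the bounds for the two larger subgroups.  Otherwise each \<open>r \<in> R\<close> is
  either zero or injective on this quotient, and it cannot be injective if the quotient is infinite
  and a power of \<open>r\<close> has finite image.\<close>

lemma uniform_bound_of_finite_image:
  assumes ops: "commuting_ops R"
    and noeth: "op_noetherian G R (carrier G)"
    and N: "op_subgroup G R N"
  shows "\<exists>D K. \<forall>r\<in>R. (\<exists>k. finite ((r ^^ k) ` carrier G)) \<longrightarrow>
           (\<exists>Y\<subseteq>carrier G. finite Y \<and> card Y \<le> K \<and> covered_by ((r ^^ D) ` carrier G) Y N)"
  using noeth N op_subgroupD(2)[OF N]
proof (induction N rule: op_noetherian_induct)
  case (step N)
  note R = commuting_opsD(1)[OF ops] and comm = commuting_opsD(2)[OF ops]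
  note ND = op_subgroupD[OF step.hyps(1)]
  let ?J = "\<lambda>r. r \<in> R \<and> (\<exists>k. finite ((r ^^ k) ` carrier G))"
  have pow_closed: "(r ^^ k) x \<in> carrier G" if "r \<in> R" "x \<in> carrier G" for r k x
    using hom_funpow[of r G k] R that by (auto simp: hom_def)
  have pow_inv: "(r ^^ k) x \<in> N" if "r \<in> R" "x \<in> N" for r k x
    using that ND(6) by (induction k) auto
  consider (split) \<mu> where "\<mu> \<in> R" "N \<subset> {x \<in> carrier G. \<mu> x \<in> N}"
      "N \<subset> {n \<otimes> \<mu> x | n x. n \<in> N \<and> x \<in> carrier G}"
    | (fin) Y where "finite Y" "Y \<subseteq> carrier G" "covered_by (carrier G) Y N"
    | (inf) "\<And>\<mu>. \<mu> \<in> R \<Longrightarrow> \<not> (N \<subset> {x \<in> carrier G. \<mu> x \<in> N} \<and>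
        N \<subset> {n \<otimes> \<mu> x | n x. n \<in> N \<and> x \<in> carrier G})"
      "\<not> (\<exists>Y\<subseteq>carrier G. finite Y \<and> covered_by (carrier G) Y N)" by blast
  then show ?case
  proof cases
    case split
    let ?N1 = "{x \<in> carrier G. \<mu> x \<in> N}"
    let ?N2 = "{n \<otimes> \<mu> x | n x. n \<in> N \<and> x \<in> carrier G}"
    interpret \<mu>: group_hom G G \<mu> by unfold_locales (use split(1) R in blast)
    have op: "op_subgroup G R ?N1" "op_subgroup G R ?N2"
      using op_subgroup_preimage_image[OF ops step.hyps(1) split(1)] by blast+
    obtain D1 K1 where 1: "\<And>r. ?J r \<Longrightarrow> \<exists>Y\<subseteq>carrier G. finite Y \<and> card Y \<le> K1 \<and> covered_by ((r ^^ D1) ` carrier G) Y ?N1"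
      using step.IH[OF op(1) op_subgroupD(2)[OF op(1)] split(2)] by meson
    obtain D2 K2 where 2: "\<And>r. ?J r \<Longrightarrow> \<exists>Y\<subseteq>carrier G. finite Y \<and> card Y \<le> K2 \<and> covered_by ((r ^^ D2) ` carrier G) Y ?N2"
      using step.IH[OF op(2) op_subgroupD(2)[OF op(2)] split(3)] by meson
    show ?thesis
    \<comment> \<open>After \<open>D2\<close> steps an element is one of \<open>K2\<close>
      representatives times \<open>\<mu> u\<close>, modulo \<open>N\<close>. As \<open>r\<close>
      commutes with \<open>\<mu>\<close>, the next \<open>D1\<close> steps act on \<open>u\<close>,
      leaving \<open>K1\<close> choices modulo the preimage of \<open>N\<close>, which
      \<open>\<mu>\<close> sends into \<open>N\<close>.\<close>
    proof (rule exI[of _ "D1 + D2"], rule exI[of _ "K2 * K1"], intro ballI impI)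
      fix r assume r: "r \<in> R" and "\<exists>k. finite ((r ^^ k) ` carrier G)"
      then have J: "?J r" by blast
      obtain Y1 where Y1: "Y1 \<subseteq> carrier G" "finite Y1" "card Y1 \<le> K1" "covered_by ((r ^^ D1) ` carrier G) Y1 ?N1"
        using 1[OF J] by blast
      obtain Y2 where Y2: "Y2 \<subseteq> carrier G" "finite Y2" "card Y2 \<le> K2" "covered_by ((r ^^ D2) ` carrier G) Y2 ?N2"
        using 2[OF J] by blast
      interpret rD: group_hom G G "r ^^ D1"
        by unfold_locales (use hom_funpow r R in blast)
      let ?Y = "(\<lambda>(y, z). (r ^^ D1) y \<otimes> \<mu> z) ` (Y2 \<times> Y1)"
      have "covered_by ((r ^^ (D1 + D2)) ` carrier G) ?Y N"
        unfolding covered_by_def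
      proof
        fix v assume "v \<in> (r ^^ (D1 + D2)) ` carrier G"
        then obtain x where x: "x \<in> carrier G" "v = (r ^^ D1) ((r ^^ D2) x)" by (auto simp: funpow_add)
        obtain y n u where y: "y \<in> Y2" "n \<in> N" "u \<in> carrier G" "(r ^^ D2) x = y \<otimes> (n \<otimes> \<mu> u)"
          using Y2(4) x(1) unfolding covered_by_def by blast
        obtain z m where z: "z \<in> Y1" "m \<in> carrier G" "\<mu> m \<in> N" "(r ^^ D1) u = z \<otimes> m"
          using Y1(4) y(3) unfolding covered_by_def by blast
        have car: "y \<in> carrier G" "n \<in> carrier G" "z \<in> carrier G" using y z Y1 Y2 ND(2) by auto
        have "(r ^^ D1) (\<mu> u) = \<mu> ((r ^^ D1) u)"
          using funpow_commute[of r \<mu> u D1] R r split(1) comm y(3) by (simp add: subset_iff)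
        then have "v = ((r ^^ D1) y \<otimes> \<mu> z) \<otimes> ((r ^^ D1) n \<otimes> \<mu> m)"
          using x y z car by (simp add: m_ac)
        moreover have "(r ^^ D1) n \<otimes> \<mu> m \<in> N" using pow_inv[OF r y(2)] z(3) ND(4) by blast
        moreover have "(r ^^ D1) y \<otimes> \<mu> z \<in> ?Y" using y(1) z(1) by force
        ultimately show "\<exists>y\<in>?Y. \<exists>n\<in>N. v = y \<otimes> n" by blast
      qed
      moreover have "card ?Y \<le> K2 * K1"
        using card_image_le[of "Y2 \<times> Y1"] Y1 Y2 mult_le_mono[OF Y2(3) Y1(3)]
        by (metis card_cartesian_product finite_cartesian_product order.trans)
      moreover have "?Y \<subseteq> carrier G" using subsetD[OF Y1(1)] subsetD[OF Y2(1)] by auto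
      ultimately show "\<exists>Y\<subseteq>carrier G. finite Y \<and> card Y \<le> K2 * K1 \<and> covered_by ((r ^^ (D1 + D2)) ` carrier G) Y N"
        using Y1(2) Y2(2) by (intro exI[of _ ?Y]) auto
    qed
  next
    case fin
    \<comment> \<open>Coset representatives of a finite quotient serve every \<open>r\<close> at
      once, with exponent 0.\<close>
    then show ?thesis by (intro exI[of _ 0] exI[of _ "card Y"]) auto
  next
    case inf
    have "r x \<in> N" if r: "r \<in> R" and k: "finite ((r ^^ k) ` carrier G)" and x: "x \<in> carrier G" for r k x
    proof (rule ccontr)
      assume rx: "r x \<notin> N"
      interpret r: group_hom G G r by unfold_locales (use r R in blast)
      interpret rk: group_hom G G "r ^^ k" by unfold_locales (use hom_funpow r R in blast)
      let ?N1 = "{x \<in> carrier G. r x \<in> N}" and ?N2 = "{n \<otimes> r x | n x. n \<in> N \<and> x \<in> carrier G}"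
      have "N \<subseteq> ?N1" using ND(2,6) r by auto
      moreover have "N \<subseteq> ?N2"
      proof
        fix n assume n: "n \<in> N"
        have "n = n \<otimes> r \<one>" using n ND(2) by auto
        then show "n \<in> ?N2" using n by blast
      qed
      moreover have "r x \<in> ?N2"
      proof -
        have "r x = \<one> \<otimes> r x" using x by simp
        then show ?thesis using x ND(3) by blast
      qed
      \<comment> \<open>Since \<open>r x\<close> is outside \<open>N\<close>, the image is strictly
        larger than \<open>N\<close>; so the kernel modulo \<open>N\<close> must be trivial, and
        \<open>r\<close> is injective modulo \<open>N\<close>.\<close>
      ultimately have N1: "?N1 = N" using inf(1)[OF r] rx by blast
      have inj: "(r ^^ j) x \<in> N \<Longrightarrow> x \<in> N" if "x \<in> carrier G" for j x
        using that
      proof (induction j)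
        case (Suc j)
        have "r ((r ^^ j) x) \<in> N" "(r ^^ j) x \<in> carrier G" using Suc.prems pow_closed[OF r] by auto
        then have "(r ^^ j) x \<in> N" using N1 by blast
        then show ?case using Suc by blast
      qed simp
      \<comment> \<open>\<open>s\<close> picks one preimage under \<open>r ^^ k\<close> for each of
        finitely many values. Two preimages of a value differ by an element of the kernel of
        \<open>r ^^ k\<close>, which lies in \<open>N\<close> by injectivity; hence there are only
        finitely many cosets, a contradiction.\<close>
      define s where "s v = (SOME y. y \<in> carrier G \<and> (r ^^ k) y = v)" for v
      have s: "s ((r ^^ k) y) \<in> carrier G \<and> (r ^^ k) (s ((r ^^ k) y)) = (r ^^ k) y" if "y \<in> carrier G" for y
        unfolding s_def by (rule someI_ex) (use that in blast)
      let ?Y = "s ` (r ^^ k) ` carrier G"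
      have "covered_by (carrier G) ?Y N"
        unfolding covered_by_def
      proof
        fix y assume y: "y \<in> carrier G"
        let ?z = "s ((r ^^ k) y)"
        have z: "?z \<in> carrier G" "(r ^^ k) ?z = (r ^^ k) y" using s[OF y] by auto
        then have "(r ^^ k) (inv ?z \<otimes> y) = \<one>" using y by simp
        then have "inv ?z \<otimes> y \<in> N" using inj[of "inv ?z \<otimes> y" k] z y ND(3) by simp
        moreover have "y = ?z \<otimes> (inv ?z \<otimes> y)" using z y by (simp flip: m_assoc)
        ultimately show "\<exists>a\<in>?Y. \<exists>n\<in>N. y = a \<otimes> n" using y by blast
      qed
      moreover have "?Y \<subseteq> carrier G" using s by auto
      ultimately show False using inf(2) k by blast
    qed
    then have rN: "r x \<in> N" if "?J r" "x \<in> carrier G" for r x using that by blast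
    show ?thesis
    proof (rule exI[of _ 1], rule exI[of _ 1], intro ballI impI)
      fix r assume "r \<in> R" and "\<exists>k. finite ((r ^^ k) ` carrier G)"
      then have J: "?J r" by blast
      have "covered_by ((r ^^ 1) ` carrier G) {\<one>} N"
        unfolding covered_by_def
      proof clarify
        fix x assume x: "x \<in> carrier G"
        have "r x \<in> N" using rN[OF J x] .
        moreover from this have "r x = \<one> \<otimes> r x" using subsetD[OF ND(2)] by simp
        ultimately show "\<exists>y\<in>{\<one>}. \<exists>n\<in>N. (r ^^ 1) x = y \<otimes> n" by auto
      qed
      then show "\<exists>Y\<subseteq>carrier G. finite Y \<and> card Y \<le> 1 \<and> covered_by ((r ^^ 1) ` carrier G) Y N"
        by (intro exI[of _ "{\<one>}"]) auto
    qed
  qed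
qed

section \<open>Orbits of a single affine map\<close>

lemma affine_funpow:
  assumes r: "r \<in> hom G G" and c: "c \<in> carrier G" and x: "x \<in> carrier G"
  shows "((\<lambda>y. r y \<otimes> c) ^^ k) x = (r ^^ k) x \<otimes> ((\<lambda>y. r y \<otimes> c) ^^ k) \<one>"
proof -
  interpret r: group_hom G G r by unfold_locales (fact r)
  have "((\<lambda>y. r y \<otimes> c) ^^ k) \<one> \<in> carrier G" "(r ^^ k) x \<in> carrier G" for k
    using x c by (induction k) auto
  then show ?thesis by (induction k) (use x c in \<open>auto simp: m_assoc\<close>)
qed

lemma funpow_mult_fixed: "(f ^^ p) x = x \<Longrightarrow> (f ^^ (p * k)) x = x"
  by (induction k) (auto simp: funpow_add)

lemma funpow_orbit_finite:
  assumes "(f ^^ p) x = x" "0 < p"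
  shows "finite (range (\<lambda>j. (f ^^ j) x))"
proof (rule finite_subset)
  show "range (\<lambda>j. (f ^^ j) x) \<subseteq> (\<lambda>j. (f ^^ j) x) ` {..<p}"
  proof clarify
    fix j
    have "(f ^^ j) x = (f ^^ (j mod p)) x"
      using funpow_mod_eq[OF assms(1)] by simp
    then show "(f ^^ j) x \<in> (\<lambda>j. (f ^^ j) x) ` {..<p}" using assms(2) by (metis image_eqI lessThan_iff mod_less_divisor)
  qed
qed simp

text \<open>If \<open>p\<close> is a period of \<open>\<one>\<close>, then the orbit of \<open>\<one>\<close> consists of fixed points of \<open>r ^^ p\<close>, and every
  element is mapped to such a fixed point by some power of \<open>r ^^ p\<close>; the Noetherian property makes
  this power uniform.\<close>

lemma finite_image_of_affine:
  assumes ops: "commuting_ops R"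
    and noeth: "op_noetherian G R (carrier G)"
    and r: "r \<in> R" and c: "c \<in> carrier G"
    and hit: "\<And>x. x \<in> carrier G \<Longrightarrow> \<exists>d\<ge>1. ((\<lambda>y. r y \<otimes> c) ^^ d) x = \<one>"
  shows "\<exists>k. finite ((r ^^ k) ` carrier G)"
proof -
  note R = commuting_opsD(1)[OF ops] and comm = commuting_opsD(2)[OF ops]
  define \<phi> where "\<phi> = (\<lambda>y. r y \<otimes> c)"
  have rhom: "r \<in> hom G G" using R r by blast
  interpret r: group_hom G G r by unfold_locales (fact rhom)
  have rk: "group_hom G G (r ^^ k)" for k by unfold_locales (rule hom_funpow[OF rhom])
  note rk_closed = group_hom.hom_closed[OF rk]
  note aff = affine_funpow[OF rhom c, folded \<phi>_def]
  have \<phi>_closed: "(\<phi> ^^ k) x \<in> carrier G" if "x \<in> carrier G" for x k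
    using that c by (induction k) (auto simp: \<phi>_def)
  obtain p where p: "p \<ge> 1" "(\<phi> ^^ p) \<one> = \<one>" using hit[OF one_closed] by (auto simp: \<phi>_def)
  define C where "C = range (\<lambda>j. (\<phi> ^^ j) \<one>)"
  \<comment> \<open>At multiples of the period the translation part, which is the orbit of
    \<open>\<one>\<close>, vanishes.\<close>
  have lin: "(\<phi> ^^ (p * k)) x = (r ^^ (p * k)) x" if "x \<in> carrier G" for k x
    using aff[OF that, of "p * k"] funpow_mult_fixed[of p \<phi> \<one> k, OF p(2)] rk_closed[OF that] by simp
  have C_fix: "(r ^^ p) x = x" if x: "x \<in> C" for x
  proof -
    obtain j where j: "x = (\<phi> ^^ j) \<one>" using x by (auto simp: C_def)
    have "(r ^^ p) x = (\<phi> ^^ p) ((\<phi> ^^ j) \<one>)" using lin[of x 1] \<phi>_closed j by simp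
    also have "\<dots> = (\<phi> ^^ j) ((\<phi> ^^ p) \<one>)" by (metis add.commute comp_apply funpow_add)
    finally show ?thesis using j p by simp
  qed
  have toC: "\<exists>k0. \<forall>k\<ge>k0. (r ^^ (p * k)) x \<in> C" if x: "x \<in> carrier G" for x
  proof -
    obtain d where d: "(\<phi> ^^ d) x = \<one>" using hit[OF x] by (auto simp: \<phi>_def)
    have "(r ^^ (p * k)) x \<in> C" if "k \<ge> d" for k
    proof -
      have "d \<le> p * k" using that p(1) by (metis mult_le_mono mult_1)
      then have "(\<phi> ^^ (p * k)) x = (\<phi> ^^ (p * k - d)) ((\<phi> ^^ d) x)"
        by (metis add.commute comp_apply funpow_add le_add_diff_inverse)
      then show ?thesis using lin[OF x] d by (auto simp: C_def)
    qed
    then show ?thesis by blast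
  qed
  \<comment> \<open>The kernel of \<open>(r ^^ p - 1) r ^^ (p * k)\<close> in additive notation: an
    ascending chain of submodules, which makes the power independent of \<open>x\<close>.\<close>
  define E where "E k = {x \<in> carrier G. (r ^^ p) ((r ^^ (p * k)) x) = (r ^^ (p * k)) x}" for k
  have E_op: "op_subgroup G R (E k)" for k
    unfolding op_subgroup_def
  proof (intro conjI ballI)
    interpret a: group_hom G G "r ^^ p" by (rule rk)
    interpret b: group_hom G G "r ^^ (p * k)" by (rule rk)
    show "subgroup (E k) G" unfolding E_def by unfold_locales auto
    fix s x assume s: "s \<in> R" and x: "x \<in> E k"
    interpret s: group_hom G G s by unfold_locales (use s R in blast)
    have x': "x \<in> carrier G" "(r ^^ p) ((r ^^ (p * k)) x) = (r ^^ (p * k)) x" using x by (auto simp: E_def)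
    have "s ((r ^^ j) y) = (r ^^ j) (s y)" if "y \<in> carrier G" for j y
      using funpow_commute[OF rhom s.homh comm[OF s r] that] .
    then have "(r ^^ p) ((r ^^ (p * k)) (s x)) = (r ^^ (p * k)) (s x)" using x' by (metis b.hom_closed)
    then show "s x \<in> E k" using x' by (simp add: E_def)
  qed
  have E_inc: "E k \<subseteq> E (Suc k)" for k
    by (auto simp: E_def funpow_add)
  obtain n where n: "\<And>m. m \<ge> n \<Longrightarrow> E m = E n"
    by (rule op_noetherianD[OF noeth, of E]) (use E_op E_inc in \<open>auto simp: E_def\<close>)
  have "(r ^^ (p * n)) x \<in> C" if x: "x \<in> carrier G" for x
  proof -
    obtain k0 where k0: "\<And>k. k \<ge> k0 \<Longrightarrow> (r ^^ (p * k)) x \<in> C" using toC[OF x] by blast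
    \<comment> \<open>The index \<open>k0\<close> depends on \<open>x\<close>, but membership in
      \<open>E\<close> descends to \<open>n\<close>. From then on \<open>r ^^ p\<close> does not
      move the iterate, so its value at \<open>n\<close> equals the value at \<open>n + k0\<close>,
      which is in \<open>C\<close>.\<close>
    have "x \<in> E (max n k0)" using x k0[of "max n k0"] C_fix by (auto simp: E_def)
    then have "x \<in> E n" using n[of "max n k0"] by simp
    then have fixed: "(r ^^ p) ((r ^^ (p * n)) x) = (r ^^ (p * n)) x" by (simp add: E_def)
    have "(r ^^ (p * (n + k0))) x = (r ^^ (p * k0 + p * n)) x" by (simp add: algebra_simps)
    also have "\<dots> = (r ^^ (p * k0)) ((r ^^ (p * n)) x)" by (simp only: funpow_add o_apply)
    also have "\<dots> = (r ^^ (p * n)) x" by (rule funpow_mult_fixed[OF fixed])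
    finally show ?thesis using k0[of "n + k0"] by simp
  qed
  then have "(r ^^ (p * n)) ` carrier G \<subseteq> C" by blast
  moreover have "finite C" unfolding C_def by (rule funpow_orbit_finite) (use p in auto)
  ultimately show ?thesis using finite_subset by blast
qed

text \<open>Pigeonhole: if the first hit came after time \<open>K\<close>, two of the points at
  times 0 to \<open>K\<close> would coincide, and cutting out the loop between them would give an
  earlier hit. This earlier time is still positive because the loop ends before the hit.\<close>

lemma funpow_hit_in_finite_set:
  fixes f :: "'c \<Rightarrow> 'c"
  assumes V: "finite V" "card V \<le> K" and orbit: "\<And>j. (f ^^ j) y \<in> V"
    and hit: "\<exists>t\<ge>1. (f ^^ t) y = z"
  shows "\<exists>t\<in>{1..K}. (f ^^ t) y = z"
proof -
  define t where "t = (LEAST t. t \<ge> 1 \<and> (f ^^ t) y = z)"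
  have t: "t \<ge> 1" "(f ^^ t) y = z" using LeastI_ex[OF hit] by (auto simp: t_def)
  have least: "t \<le> s" if "s \<ge> 1" "(f ^^ s) y = z" for s unfolding t_def by (rule Least_le) (use that in simp)
  have "t \<le> K"
  proof (rule ccontr)
    assume "\<not> t \<le> K"
    then have "card V < card {..K}" using V by simp
    moreover have "(\<lambda>j. (f ^^ j) y) ` {..K} \<subseteq> V" using orbit by auto
    ultimately have "\<not> inj_on (\<lambda>j. (f ^^ j) y) {..K}"
      using card_inj_on_le[of _ "{..K}" V] V(1) by (meson leD)
    then obtain i j where ij: "i < j" "j \<le> K" "(f ^^ i) y = (f ^^ j) y"
      by (auto simp: inj_on_def) (metis linorder_neqE_nat)
    have "(f ^^ (t - j + i)) y = (f ^^ (t - j)) ((f ^^ j) y)" using ij by (simp add: funpow_add)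
    also have "\<dots> = (f ^^ (t - j + j)) y" by (simp only: funpow_add o_apply)
    also have "t - j + j = t" using ij(2) \<open>\<not> t \<le> K\<close> by simp
    finally show False using least[of "t - j + i"] t ij(1,2) \<open>\<not> t \<le> K\<close> by force
  qed
  with t show ?thesis by auto
qed

text \<open>For \<open>N\<close> trivial, the preceding bound says that \<open>r ^^ D\<close> takes
  at most \<open>K\<close> values. The affine iterate differs from it by a fixed translation, so
  after \<open>D\<close> steps the orbit stays in a set of at most \<open>K\<close> elements and
  hits \<open>\<one>\<close> within \<open>K\<close> more steps.\<close>

lemma affine_uniform_bound:
  assumes ops: "commuting_ops R"
    and noeth: "op_noetherian G R (carrier G)"
  obtains D where "\<And>r c x. r \<in> R \<Longrightarrow> c \<in> carrier G \<Longrightarrow>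
      (\<And>x. x \<in> carrier G \<Longrightarrow> \<exists>d\<ge>1. ((\<lambda>y. r y \<otimes> c) ^^ d) x = \<one>) \<Longrightarrow> x \<in> carrier G \<Longrightarrow>
      \<exists>d\<in>{1..D}. ((\<lambda>y. r y \<otimes> c) ^^ d) x = \<one>"
proof -
  note R = commuting_opsD(1)[OF ops] and comm = commuting_opsD(2)[OF ops]
  have "r \<one> = \<one>" if "r \<in> R" for r using R that hom_one[of r G G] by blast
  then have "op_subgroup G R {\<one>}" using triv_subgroup by (simp add: op_subgroup_def)
  from uniform_bound_of_finite_image[OF ops noeth this]
  obtain D K where DK: "\<And>r. r \<in> R \<Longrightarrow> \<exists>k. finite ((r ^^ k) ` carrier G) \<Longrightarrow>
      \<exists>Y\<subseteq>carrier G. finite Y \<and> card Y \<le> K \<and> covered_by ((r ^^ D) ` carrier G) Y {\<one>}"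
    by metis
  show thesis
  proof (rule that[of "D + K"])
    fix r c x
    assume r: "r \<in> R" and c: "c \<in> carrier G" and x: "x \<in> carrier G"
      and hit: "\<And>x. x \<in> carrier G \<Longrightarrow> \<exists>d\<ge>1. ((\<lambda>y. r y \<otimes> c) ^^ d) x = \<one>"
    define \<phi> where "\<phi> = (\<lambda>y. r y \<otimes> c)"
    have rhom: "r \<in> hom G G" using R r by blast
    have \<phi>_closed: "(\<phi> ^^ k) y \<in> carrier G" if "y \<in> carrier G" for y k
      using that c rhom by (induction k) (auto simp: \<phi>_def hom_def)
    obtain Y where Y: "Y \<subseteq> carrier G" "finite Y" "card Y \<le> K" "covered_by ((r ^^ D) ` carrier G) Y {\<one>}"
      using DK[OF r finite_image_of_affine[OF ops noeth r c hit]] by blast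
    let ?V = "(\<lambda>y. y \<otimes> (\<phi> ^^ D) \<one>) ` Y"
    have V: "(\<phi> ^^ D) y \<in> ?V" if y: "y \<in> carrier G" for y
    proof -
      have "(r ^^ D) y \<in> Y" using Y(1,4) y unfolding covered_by_def by fastforce
      then show ?thesis using affine_funpow[OF rhom c y, of D] by (auto simp: \<phi>_def)
    qed
    have "(\<phi> ^^ j) ((\<phi> ^^ D) x) \<in> ?V" for j
      using V[OF \<phi>_closed[OF x, of j]] by (metis add.commute comp_apply funpow_add)
    moreover have "\<exists>t\<ge>1. (\<phi> ^^ t) ((\<phi> ^^ D) x) = \<one>" using hit[OF \<phi>_closed[OF x]] by (simp add: \<phi>_def)
    moreover have "card ?V \<le> K" using card_image_le[OF Y(2)] Y(3) order.trans by blast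
    ultimately obtain t where "t \<in> {1..K}" "(\<phi> ^^ t) ((\<phi> ^^ D) x) = \<one>"
      using funpow_hit_in_finite_set[of ?V K \<phi> "(\<phi> ^^ D) x" \<one>] Y(2) by auto
    then show "\<exists>d\<in>{1..D + K}. ((\<lambda>y. r y \<otimes> c) ^^ d) x = \<one>"
      unfolding \<phi>_def[symmetric]
      by (intro bexI[of _ "t + D"]) (auto simp: funpow_add)
  qed
qed

end

section \<open>Evaluation of words\<close>

lemma word_eval_Nil [simp]: "word_eval G x [] = \<one>\<^bsub>G\<^esub>"
  by (simp add: word_eval_def)

lemma word_eval_Cons [simp]:
  "word_eval G x ((i, s) # w) = (if s then x i else inv\<^bsub>G\<^esub> x i) \<otimes>\<^bsub>G\<^esub> word_eval G x w"
  by (simp add: word_eval_def)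

lemma word_eval_cong:
  assumes "\<And>i. i \<in> fst ` set w \<Longrightarrow> x i = y i"
  shows "word_eval G x w = word_eval G y w"
  using assms by (induction w) auto

lemma (in group) word_eval_closed:
  assumes "fst ` set w \<subseteq> I" "x \<in> I \<rightarrow> carrier G"
  shows "word_eval G x w \<in> carrier G"
  using assms(1)
proof (induction w)
  case (Cons a w)
  then show ?case using assms(2) by (cases a) auto
qed simp

lemma (in group) cancel_left:
  assumes "x \<in> carrier G" "y \<in> carrier G"
  shows "x \<otimes> (inv x \<otimes> y) = y" "inv x \<otimes> (x \<otimes> y) = y"
  using assms by (simp_all flip: m_assoc)

lemma (in group) word_eval_red_cons:
  assumes "insert (fst a) (fst ` set w) \<subseteq> I" "x \<in> I \<rightarrow> carrier G"
  shows "word_eval G x (red_cons a w) = word_eval G x [a] \<otimes> word_eval G x w"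
proof -
  obtain i s where a: "a = (i, s)" by fastforce
  have xi: "x i \<in> carrier G" using assms a by auto
  show ?thesis
  proof (cases w)
    case Nil
    then show ?thesis using a xi by auto
  next
    case (Cons b v)
    have "word_eval G x v \<in> carrier G"
      by (rule word_eval_closed[of v I]) (use assms Cons in auto)
    moreover have "x (fst b) \<in> carrier G" using assms Cons by auto
    ultimately show ?thesis
      using a xi Cons by (cases b) (auto simp: inv_letter_def cancel_left)
  qed
qed

lemma (in group) word_eval_foldr_red_cons:
  assumes "fst ` set u \<subseteq> I" "fst ` set v \<subseteq> I" "x \<in> I \<rightarrow> carrier G"
  shows "word_eval G x (foldr red_cons u v) = word_eval G x u \<otimes> word_eval G x v"
  using assms(1)
proof (induction u)
  case Nil
  then show ?case using word_eval_closed[OF assms(2,3)] by simp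
next
  case (Cons a u)
  have a: "fst a \<in> I" "fst ` set u \<subseteq> I" using Cons.prems by auto
  have "fst ` set (foldr red_cons u v) \<subseteq> I"
    using letters_foldr_red_cons[of u v] a(2) assms(2) by blast
  then have "word_eval G x (foldr red_cons (a # u) v) =
      word_eval G x [a] \<otimes> (word_eval G x u \<otimes> word_eval G x v)"
    using word_eval_red_cons[of a "foldr red_cons u v" I x] a assms(3) Cons.IH[OF a(2)] by simp
  also have "\<dots> = word_eval G x (a # u) \<otimes> word_eval G x v"
    using word_eval_closed[OF a(2) assms(3)] word_eval_closed[OF assms(2,3)] funcset_mem[OF assms(3) a(1)]
    by (cases a) (auto simp: m_assoc)
  finally show ?case .
qed

lemma (in group) word_eval_hom:
  assumes "x \<in> {1..n} \<rightarrow> carrier G"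
  shows "group_hom (free_group n) G (word_eval G x)"
proof (intro group_hom.intro group_hom_axioms.intro group_free_group is_group homI)
  show "word_eval G x u \<in> carrier G" if "u \<in> carrier (free_group n)" for u
    using that word_eval_closed[OF _ assms] by (simp add: free_group_def)
  show "word_eval G x (u \<otimes>\<^bsub>free_group n\<^esub> v) = word_eval G x u \<otimes> word_eval G x v"
    if "u \<in> carrier (free_group n)" "v \<in> carrier (free_group n)" for u v
    using that word_eval_foldr_red_cons[OF _ _ assms] by (simp add: free_group_def)
qed

lemma (in group_hom) hom_word_eval:
  assumes "fst ` set w \<subseteq> I" "x \<in> I \<rightarrow> carrier G"
  shows "h (word_eval G x w) = word_eval H (\<lambda>i. h (x i)) w"
  using assms(1)
proof (induction w)
  case (Cons a w)
  obtain i s where a: "a = (i, s)" by fastforce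
  have "x i \<in> carrier G" "word_eval G x w \<in> carrier G"
    using Cons.prems assms(2) a G.word_eval_closed[of w I x] by auto
  then show ?case using Cons a by simp
qed simp

lemma free_group_letters: "w \<in> carrier (free_group n) \<Longrightarrow> fst ` set w \<subseteq> {1..n}"
  by (simp add: free_group_def)

lemma engel_iter_closed:
  assumes "1 \<le> n" "w \<in> carrier (free_group n)"
  shows "engel_iter n w N \<in> carrier (free_group n)"
proof -
  interpret F: group "free_group n" by (rule group_free_group)
  have gen: "[(i, True)] \<in> carrier (free_group n)" if "i \<in> {1..n}" for i
    using that by (simp add: free_group_def reduced_def)
  show ?thesis
  proof (induction N)
    case 0
    then show ?case using gen assms(1) by simp
  next
    case (Suc N)
    show ?case
    proof (cases N)
      case N: (Suc N')
      show ?thesis unfolding N engel_iter.simps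
        by (rule F.word_eval_closed[OF free_group_letters[OF assms(2)]])
          (use Suc.IH N gen in auto)
    qed (use assms(2) in simp)
  qed
qed

text \<open>Evaluation commutes with substitution, so iterating the word becomes iterating one
  self-map of the group. The value \<open>x_1\<close> at index 0 lets the induction start with the
  empty iterate.\<close>

lemma (in group) word_eval_engel_iter:
  assumes n: "1 \<le> n" and w: "w \<in> carrier (free_group n)" and x: "x \<in> {1..n} \<rightarrow> carrier G"
  shows "word_eval G x (engel_iter n w N) = ((\<lambda>g. word_eval G (x(1 := g)) w) ^^ N) (x 1)"
proof (induction N)
  case 0
  have "x 1 \<in> carrier G" using n x by auto
  then show ?case by simp
next
  case (Suc N)
  show ?case
  proof (cases N)
    case 0
    then show ?thesis using fun_upd_triv[of x 1] by (simp del: fun_upd_apply)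
  next
    case (Suc N')
    interpret e: group_hom "free_group n" G "word_eval G x" by (rule word_eval_hom[OF x])
    have "word_eval G x (engel_iter n w (Suc N)) =
        word_eval G (\<lambda>i. word_eval G x (((\<lambda>i. [(i, True)])(1 := engel_iter n w N)) i)) w"
      unfolding Suc engel_iter.simps
      by (rule e.hom_word_eval[OF free_group_letters[OF w]])
        (use engel_iter_closed[OF n w, of "Suc N'"] in \<open>auto simp: free_group_def reduced_def\<close>)
    also have "\<dots> = word_eval G (x(1 := word_eval G x (engel_iter n w N))) w"
      by (rule word_eval_cong) (use x free_group_letters[OF w] in \<open>auto simp: Pi_iff subset_iff\<close>)
    finally show ?thesis by (simp only: Suc.IH funpow.simps o_apply)
  qed
qed

lemma (in group) word_eval_one: "word_eval G (\<lambda>_. \<one>) w = \<one>"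
proof (induction w)
  case (Cons a w)
  then show ?case by (cases a) auto
qed simp

text \<open>\<open>k\<close> is the exponent sum of \<open>x_1\<close> in \<open>w\<close>. It is
  chosen before \<open>x\<close>, so what is learned about it from trivial values of the other
  variables holds for all values.\<close>

lemma (in comm_group) word_eval_update_first:
  assumes "fst ` set w \<subseteq> I"
  shows "\<exists>k :: int. \<forall>x\<in>I \<rightarrow> carrier G. \<forall>a\<in>carrier G.
    word_eval G (x(1 := a)) w = a [^] k \<otimes> word_eval G (x(1 := \<one>)) w"
  using assms
proof (induction w)
  case Nil
  have "\<forall>x\<in>I \<rightarrow> carrier G. \<forall>a\<in>carrier G.
    word_eval G (x(1 := a)) [] = a [^] (0 :: int) \<otimes> word_eval G (x(1 := \<one>)) []" by simp
  then show ?case by blast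
next
  case (Cons b w)
  obtain i s where b: "b = (i, s)" by fastforce
  have "fst ` set w \<subseteq> I" using Cons.prems by auto
  then obtain k :: int where k: "\<And>x a. x \<in> I \<rightarrow> carrier G \<Longrightarrow> a \<in> carrier G \<Longrightarrow>
    word_eval G (x(1 := a)) w = a [^] k \<otimes> word_eval G (x(1 := \<one>)) w" using Cons.IH by blast
  define l :: int where "l = (if i = 1 then if s then 1 else - 1 else 0)"
  have "word_eval G (x(1 := a)) (b # w) = a [^] (l + k) \<otimes> word_eval G (x(1 := \<one>)) (b # w)"
    if x: "x \<in> I \<rightarrow> carrier G" and a: "a \<in> carrier G" for x a
  proof -
    have "word_eval G (x(1 := \<one>)) w \<in> carrier G"
      by (rule word_eval_closed[of w I]) (use Cons.prems x in auto)
    moreover have "x i \<in> carrier G" using Cons.prems x b by auto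
    ultimately show ?thesis
      using k[OF x a] a b by (auto simp: l_def int_pow_mult int_pow_neg m_ac)
  qed
  then show ?case by blast
qed

section \<open>Metabelian groups\<close>

context group
begin

abbreviation conj :: "'a \<Rightarrow> 'a \<Rightarrow> 'a" where
  "conj y m \<equiv> y \<otimes> m \<otimes> inv y"

text \<open>The elements that commute with \<open>h\<close> modulo the normal subgroup
  \<open>N\<close> form a subgroup. The identities used are
  \<open>[a b, h] = a [b, h] inv a [a, h]\<close> and its consequence for inverses.\<close>

lemma generate_commutators:
  assumes N: "subgroup N G" and conj_N: "\<And>y m. y \<in> carrier G \<Longrightarrow> m \<in> N \<Longrightarrow> conj y m \<in> N"
    and S: "S \<subseteq> carrier G" and h: "h \<in> carrier G"
    and comm: "\<And>s. s \<in> S \<Longrightarrow> s \<otimes> h \<otimes> inv s \<otimes> inv h \<in> N"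
    and g: "g \<in> generate G S"
  shows "g \<otimes> h \<otimes> inv g \<otimes> inv h \<in> N"
  using g
proof (induction g rule: generate.induct)
  case one
  then show ?case using h subgroup.one_closed[OF N] by simp
next
  case (incl s)
  then show ?case by (rule comm)
next
  case (inv s)
  then have s: "s \<in> carrier G" using S by auto
  have "conj (inv s) (inv (s \<otimes> h \<otimes> inv s \<otimes> inv h)) \<in> N"
    using conj_N s comm[OF inv] subgroup.m_inv_closed[OF N] by blast
  also have "conj (inv s) (inv (s \<otimes> h \<otimes> inv s \<otimes> inv h)) = inv s \<otimes> h \<otimes> inv (inv s) \<otimes> inv h"
    using s h by (simp add: m_assoc inv_mult_group cancel_left)
  finally show ?case .
next
  case (eng a b)
  then have ab: "a \<in> carrier G" "b \<in> carrier G" using generate_in_carrier[OF S] by auto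
  have "conj a (b \<otimes> h \<otimes> inv b \<otimes> inv h) \<otimes> (a \<otimes> h \<otimes> inv a \<otimes> inv h) \<in> N"
    using eng.IH conj_N[OF ab(1)] subgroup.m_closed[OF N] by blast
  also have "conj a (b \<otimes> h \<otimes> inv b \<otimes> inv h) \<otimes> (a \<otimes> h \<otimes> inv a \<otimes> inv h) =
      a \<otimes> b \<otimes> h \<otimes> inv (a \<otimes> b) \<otimes> inv h"
    using ab h by (simp add: m_assoc inv_mult_group cancel_left)
  finally show ?case .
qed

text \<open>\<open>generate_commutators\<close> is applied once in each argument of the commutator.
  Invariance under inverses of generators is a separate hypothesis because conjugation by
  \<open>s\<close> could map \<open>N\<close> onto a proper subgroup of itself.\<close>

lemma derived_subset_of_generators:
  assumes S: "S \<subseteq> carrier G" "generate G S = carrier G"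
    and N: "subgroup N G" and comm: "\<And>s t. s \<in> S \<Longrightarrow> t \<in> S \<Longrightarrow> s \<otimes> t \<otimes> inv s \<otimes> inv t \<in> N"
    and conj_S: "\<And>s m. s \<in> S \<Longrightarrow> m \<in> N \<Longrightarrow> conj s m \<in> N" "\<And>s m. s \<in> S \<Longrightarrow> m \<in> N \<Longrightarrow> conj (inv s) m \<in> N"
  shows "derived G (carrier G) \<subseteq> N"
proof -
  have conj_N: "conj y m \<in> N" if "y \<in> carrier G" "m \<in> N" for y m
  proof -
    have "y \<in> generate G S" using that S by simp
    then show ?thesis using that(2)
    proof (induction y arbitrary: m rule: generate.induct)
      case one
      then show ?case using subgroup.mem_carrier[OF N] by simp
    next
      case (eng a b)
      then have "a \<in> carrier G" "b \<in> carrier G" "m \<in> carrier G"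
        using subgroup.mem_carrier[OF N] S(2) by auto
      then have "conj (a \<otimes> b) m = conj a (conj b m)" by (simp add: m_assoc inv_mult_group)
      then show ?case using eng by simp
    qed (use conj_S in auto)
  qed
  have 1: "g \<otimes> s \<otimes> inv g \<otimes> inv s \<in> N" if "g \<in> carrier G" "s \<in> S" for g s
    using generate_commutators[OF N conj_N S(1), of s g] comm that S by auto
  have 2: "s \<otimes> g \<otimes> inv s \<otimes> inv g \<in> N" if "g \<in> carrier G" "s \<in> S" for g s
  proof -
    have "s \<in> carrier G" using that S by auto
    then have "s \<otimes> g \<otimes> inv s \<otimes> inv g = inv (g \<otimes> s \<otimes> inv g \<otimes> inv s)"
      using that by (simp add: m_assoc inv_mult_group)
    then show ?thesis using 1[OF that] subgroup.m_inv_closed[OF N] by simp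
  qed
  have "g \<otimes> h \<otimes> inv g \<otimes> inv h \<in> N" if "g \<in> carrier G" "h \<in> carrier G" for g h
    using generate_commutators[OF N conj_N S(1), of h g] 2 that S by auto
  then show ?thesis
    unfolding derived_def by (intro generate_subgroup_incl[OF _ N]) auto
qed

text \<open>The maps on the derived subgroup given by the elements of the integral group ring,
  built up in the order in which a word is read.\<close>

inductive_set ring_ops :: "('a \<Rightarrow> 'a) set" where
  zero: "(\<lambda>_. \<one>) \<in> ring_ops"
| plus: "r \<in> ring_ops \<Longrightarrow> (\<lambda>m. m \<otimes> r m) \<in> ring_ops"
| minus: "r \<in> ring_ops \<Longrightarrow> (\<lambda>m. inv m \<otimes> r m) \<in> ring_ops"
| conj: "r \<in> ring_ops \<Longrightarrow> y \<in> carrier G \<Longrightarrow> (\<lambda>m. conj y (r m)) \<in> ring_ops"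

end

locale metabelian_group = group G for G (structure) +
  assumes metabelian: "metabelian G"
begin

abbreviation "D \<equiv> derived G (carrier G)"
abbreviation "GD \<equiv> G\<lparr>carrier := D\<rparr>"

sublocale D: normal D G by (rule derived_self_is_normal)
sublocale M: comm_group GD using metabelian by (simp add: metabelian_def)

lemma D_comm: "a \<in> D \<Longrightarrow> b \<in> D \<Longrightarrow> a \<otimes> b = b \<otimes> a"
  using M.m_comm by simp

lemma inv_GD: "a \<in> D \<Longrightarrow> inv\<^bsub>GD\<^esub> a = inv a"
  by (rule m_inv_consistent[OF D.subgroup_axioms])

lemma conj_D: "y \<in> carrier G \<Longrightarrow> m \<in> D \<Longrightarrow> conj y m \<in> D"
  using D.inv_op_closed2 .

lemma commutator_D:
  "g \<in> carrier G \<Longrightarrow> h \<in> carrier G \<Longrightarrow> g \<otimes> h \<otimes> inv g \<otimes> inv h \<in> D"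
  unfolding derived_def by (rule generate.incl) blast

text \<open>\<open>z \<otimes> y\<close> and \<open>y \<otimes> z\<close> differ by a commutator
  \<open>c\<close>, which acts trivially on the abelian group \<open>D\<close>. So the action on
  \<open>D\<close> factors through the abelianization.\<close>

lemma conj_commute:
  assumes y: "y \<in> carrier G" and z: "z \<in> carrier G" and m: "m \<in> D"
  shows "conj z (conj y m) = conj y (conj z m)"
proof -
  have m': "m \<in> carrier G" using m by simp
  define c where "c = inv z \<otimes> inv y \<otimes> inv (inv z) \<otimes> inv (inv y)"
  have c: "c \<in> D" unfolding c_def by (rule commutator_D) (use y z in auto)
  have "c \<otimes> m = m \<otimes> c" by (rule D_comm[OF c m])
  then have m_eq: "c \<otimes> m \<otimes> inv c = m" using c m' by (simp add: m_assoc)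
  have zy: "z \<otimes> y = y \<otimes> z \<otimes> c" using y z by (simp add: c_def m_assoc cancel_left)
  have "conj z (conj y m) = conj (z \<otimes> y) m" using y z m' by (simp add: m_assoc inv_mult_group)
  also have "\<dots> = conj (y \<otimes> z) (c \<otimes> m \<otimes> inv c)"
    using y z m' c by (simp add: zy m_assoc inv_mult_group)
  also have "\<dots> = conj y (conj z m)" using y z m' by (simp add: m_eq) (simp add: m_assoc inv_mult_group)
  finally show ?thesis .
qed

lemma conj_mult:
  assumes "y \<in> carrier G" "a \<in> carrier G" "b \<in> carrier G"
  shows "conj y (a \<otimes> b) = conj y a \<otimes> conj y b"
  using assms by (simp add: m_assoc cancel_left)

lemma ring_ops_closed: "r \<in> ring_ops \<Longrightarrow> m \<in> D \<Longrightarrow> r m \<in> D"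
  by (induction rule: ring_ops.induct) (auto simp: conj_D)

lemma ring_ops_mult:
  assumes "r \<in> ring_ops" "a \<in> D" "b \<in> D"
  shows "r (a \<otimes> b) = r a \<otimes> r b"
  using assms
proof (induction rule: ring_ops.induct)
  case (plus r)
  have "r a \<in> D" "r b \<in> D" using plus ring_ops_closed by auto
  then show ?case using plus M.m_ac by simp
next
  case (minus r)
  have "r a \<in> D" "r b \<in> D" using minus ring_ops_closed by auto
  moreover have "inv (a \<otimes> b) = inv a \<otimes> inv b" using M.inv_mult[of a b] minus by (simp add: inv_GD)
  ultimately show ?case using minus M.m_ac by simp
next
  case (conj r y)
  have "r a \<in> D" "r b \<in> D" using conj ring_ops_closed by auto
  then show ?case using conj conj_mult by simp
qed simp

lemma ring_ops_hom:
  assumes "r \<in> ring_ops"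
  shows "r \<in> hom GD GD"
  using ring_ops_closed[OF assms] ring_ops_mult[OF assms] by (auto intro!: homI)

lemma ring_ops_group_hom: "r \<in> ring_ops \<Longrightarrow> group_hom GD GD r"
  by unfold_locales (rule ring_ops_hom)

lemma ring_ops_one: "r \<in> ring_ops \<Longrightarrow> r \<one> = \<one>"
  using group_hom.hom_one[OF ring_ops_group_hom] by simp

lemma ring_ops_inv:
  assumes "r \<in> ring_ops" "a \<in> D"
  shows "r (inv a) = inv (r a)"
  using group_hom.hom_inv[OF ring_ops_group_hom[OF assms(1)], of a] assms ring_ops_closed
  by (simp add: inv_GD)

lemma ring_ops_conj:
  assumes "r \<in> ring_ops" "y \<in> carrier G" "a \<in> D"
  shows "r (conj y a) = conj y (r a)"
  using assms
proof (induction rule: ring_ops.induct)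
  case (plus r)
  have "r a \<in> D" using plus ring_ops_closed by auto
  then show ?case using plus conj_mult[of y a "r a"] by simp
next
  case (minus r)
  have "r a \<in> D" using minus ring_ops_closed by auto
  moreover have "inv (conj y a) = conj y (inv a)" using minus by (simp add: inv_mult_group m_assoc)
  ultimately show ?case using minus conj_mult[of y "inv a" "r a"] by simp
next
  case (conj r z)
  then show ?case using conj_commute[of y z "r a"] ring_ops_closed by simp
qed simp

text \<open>Induction on \<open>r\<close> alone: each building step uses only that \<open>s\<close>
  is additive and commutes with conjugation.\<close>

lemma ring_ops_commute:
  assumes r: "r \<in> ring_ops" and s: "s \<in> ring_ops" and m: "m \<in> D"
  shows "r (s m) = s (r m)"
  using r
proof (induction rule: ring_ops.induct)
  case zero
  then show ?case using ring_ops_one[OF s] by simp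
next
  case (plus r)
  then show ?case using ring_ops_mult[OF s m ring_ops_closed[OF plus(1) m]] by simp
next
  case (minus r)
  then show ?case using ring_ops_mult[OF s _ ring_ops_closed[OF minus(1) m], of "inv m"] ring_ops_inv[OF s m] m by simp
next
  case (conj r y)
  then show ?case using ring_ops_conj[OF s conj(2) ring_ops_closed[OF conj(1) m]] by simp
qed

lemma commuting_ring_ops: "M.commuting_ops ring_ops"
  using ring_ops_hom ring_ops_commute by (auto simp: M.commuting_ops_def)

text \<open>The factor \<open>\<one>\<close> comes from building the identity operator as
  \<open>plus\<close> applied to \<open>zero\<close>. It is kept because membership concerns
  functions on the whole type, and \<open>m \<otimes> \<one>\<close> is known to equal
  \<open>m\<close> only inside the carrier.\<close>

lemma conj_in_ring_ops: "y \<in> carrier G \<Longrightarrow> (\<lambda>m. conj y (m \<otimes> \<one>)) \<in> ring_ops"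
  by (intro ring_ops.intros)

text \<open>A Noetherian submodule that contains the commutators of generators and is stable under
  conjugation by generators and their inverses is all of \<open>D\<close>.\<close>

lemma derived_noetherian:
  assumes "finitely_generated G"
  shows "op_noetherian GD ring_ops D"
proof -
  obtain S where S: "S \<subseteq> carrier G" "finite S" "generate G S = carrier G"
    using assms by (auto simp: finitely_generated_def)
  define \<Omega> where "\<Omega> = (\<lambda>y m. conj y (m \<otimes> \<one>)) ` (S \<union> (\<lambda>s. inv s) ` S)"
  define Y where "Y = (\<lambda>(s, t). s \<otimes> t \<otimes> inv s \<otimes> inv t) ` (S \<times> S)"
  have "S \<union> (\<lambda>s. inv s) ` S \<subseteq> carrier G" using S(1) by auto
  then have \<Omega>: "\<Omega> \<subseteq> ring_ops" unfolding \<Omega>_def using conj_in_ring_ops by blast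
  have "M.commuting_ops \<Omega>" using commuting_ring_ops \<Omega> unfolding M.commuting_ops_def by blast
  moreover have "finite \<Omega>" "finite Y" using S(2) by (auto simp: \<Omega>_def Y_def)
  moreover have "Y \<subseteq> carrier GD" using S(1) commutator_D by (auto simp: Y_def)
  ultimately obtain K where K: "op_subgroup GD \<Omega> K" "Y \<subseteq> K" "op_noetherian GD \<Omega> K"
    using M.noetherian_finite_operators by blast
  note KD = M.op_subgroupD[OF K(1)]
  have conj_K: "conj y m \<in> K" if "y \<in> S \<union> (\<lambda>s. inv s) ` S" "m \<in> K" for y m
  proof -
    have "conj y (m \<otimes> \<one>) \<in> K" using KD(6)[of "\<lambda>m. conj y (m \<otimes> \<one>)" m] that by (auto simp: \<Omega>_def)
    moreover have "m \<in> carrier G" using that(2) KD(2) by auto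
    ultimately show ?thesis by simp
  qed
  have "D \<subseteq> K"
  proof (rule derived_subset_of_generators[OF S(1,3)])
    show "subgroup K G" by (rule incl_subgroup[OF D.subgroup_axioms KD(1)])
    show "s \<otimes> t \<otimes> inv s \<otimes> inv t \<in> K" if "s \<in> S" "t \<in> S" for s t
      using that K(2) by (auto simp: Y_def)
  qed (use conj_K in auto)
  then have "K = D" using KD(2) by simp
  then have "op_noetherian GD \<Omega> D" using K(3) by simp
  then show ?thesis
    by (rule op_noetherian_mono_ops) (use \<Omega> in \<open>auto simp: op_subgroup_def\<close>)
qed

text \<open>Each occurrence of \<open>m\<close> is moved to the front past the letters on its left,
  at the price of conjugating by them. The operator \<open>r\<close> is the Fox derivative of
  \<open>w\<close> with respect to \<open>x_1\<close>, evaluated at \<open>x_1 = 1\<close>; it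
  depends on \<open>x\<close> but always lies in \<open>ring_ops\<close>.\<close>

lemma word_eval_affine:
  assumes "fst ` set w \<subseteq> I" "x \<in> I \<rightarrow> carrier G"
  shows "\<exists>r\<in>ring_ops. \<forall>m\<in>D. word_eval G (x(1 := m)) w = r m \<otimes> word_eval G (x(1 := \<one>)) w"
  using assms(1)
proof (induction w)
  case Nil
  then show ?case using ring_ops.zero by force
next
  case (Cons a w)
  obtain i s where a: "a = (i, s)" by fastforce
  obtain r where r: "r \<in> ring_ops"
    and eq: "\<And>m. m \<in> D \<Longrightarrow> word_eval G (x(1 := m)) w = r m \<otimes> word_eval G (x(1 := \<one>)) w"
    using Cons.IH Cons.prems by (metis image_subset_iff list.set_intros(2))
  have xi: "x i \<in> carrier G" using Cons.prems assms(2) a by auto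
  define v where "v = word_eval G (x(1 := \<one>)) w"
  have v: "v \<in> carrier G"
    unfolding v_def by (rule word_eval_closed[of w I]) (use Cons.prems assms(2) in auto)
  have rm: "r m \<in> carrier G" if "m \<in> D" for m using ring_ops_closed[OF r that] by simp
  consider "i = 1" s | "i = 1" "\<not> s" | "i \<noteq> 1" by blast
  then show ?case
  proof cases
    case 1
    have "word_eval G (x(1 := m)) (a # w) = (m \<otimes> r m) \<otimes> word_eval G (x(1 := \<one>)) (a # w)"
      if "m \<in> D" for m
    proof -
      have "word_eval G (x(1 := m)) (a # w) = m \<otimes> (r m \<otimes> v)"
        using a 1 eq[OF that] by (simp add: v_def fun_upd_same fun_upd_other del: fun_upd_apply)
      moreover have "word_eval G (x(1 := \<one>)) (a # w) = v"
        using a 1 v by (simp add: v_def fun_upd_same fun_upd_other del: fun_upd_apply)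
      ultimately show ?thesis using that rm[OF that] v by (simp add: m_assoc)
    qed
    then show ?thesis by (intro bexI[OF _ ring_ops.plus[OF r]]) blast
  next
    case 2
    have "word_eval G (x(1 := m)) (a # w) = (inv m \<otimes> r m) \<otimes> word_eval G (x(1 := \<one>)) (a # w)"
      if "m \<in> D" for m
    proof -
      have "word_eval G (x(1 := m)) (a # w) = inv m \<otimes> (r m \<otimes> v)"
        using a 2 eq[OF that] by (simp add: v_def fun_upd_same fun_upd_other del: fun_upd_apply)
      moreover have "word_eval G (x(1 := \<one>)) (a # w) = v"
        using a 2 v by (simp add: v_def fun_upd_same fun_upd_other del: fun_upd_apply)
      ultimately show ?thesis using that rm[OF that] v by (simp add: m_assoc)
    qed
    then show ?thesis by (intro bexI[OF _ ring_ops.minus[OF r]]) blast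
  next
    case 3
    define y where "y = (if s then x i else inv x i)"
    have y: "y \<in> carrier G" using xi by (simp add: y_def)
    have "word_eval G (x(1 := m)) (a # w) = conj y (r m) \<otimes> word_eval G (x(1 := \<one>)) (a # w)"
      if "m \<in> D" for m
    proof -
      have "word_eval G (x(1 := m)) (a # w) = y \<otimes> (r m \<otimes> v)"
        using a 3 eq[OF that] by (simp add: y_def v_def fun_upd_same fun_upd_other del: fun_upd_apply)
      also have "\<dots> = conj y (r m) \<otimes> (y \<otimes> v)"
        using y v rm[OF that] by (simp add: m_assoc cancel_left)
      also have "y \<otimes> v = word_eval G (x(1 := \<one>)) (a # w)" using a 3 by (simp add: y_def v_def fun_upd_same fun_upd_other del: fun_upd_apply)
      finally show ?thesis .
    qed
    then show ?thesis by (intro bexI[OF _ ring_ops.conj[OF r y]]) blast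
  qed
qed

end

section \<open>Reaching the derived subgroup\<close>

lemma fun_upd_in_funcset: "x \<in> I \<rightarrow> B \<Longrightarrow> g \<in> B \<Longrightarrow> x(i := g) \<in> I \<rightarrow> B"
  by auto

lemma (in group) iterated_identity_funpow:
  assumes "1 \<le> n" "w \<in> carrier (free_group n)" "iterated_identity G n w"
    and x: "x \<in> {1..n} \<rightarrow> carrier G" and g: "g \<in> carrier G"
  shows "\<exists>N\<ge>1. ((\<lambda>g. word_eval G (x(1 := g)) w) ^^ N) g = \<one>"
proof -
  have x': "x(1 := g) \<in> {1..n} \<rightarrow> carrier G" using x g by (rule fun_upd_in_funcset)
  then obtain N where "N \<ge> 1" "word_eval G (x(1 := g)) (engel_iter n w N) = \<one>"
    using assms(3) by (auto simp: iterated_identity_def)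
  then show ?thesis
    using word_eval_engel_iter[OF assms(1,2) x', of N]
    by (intro exI[of _ N]) (simp add: fun_upd_same del: fun_upd_apply)
qed

lemma (in comm_group) int_pow_commuting_ops: "commuting_ops (range (\<lambda>(k :: int) a. a [^] k))"
  by (auto simp: commuting_ops_def hom_def int_pow_distrib int_pow_pow mult.commute)

text \<open>Evaluating at \<open>x\<^sub>2 = \<dots> = x\<^sub>n = 1\<close> shows that multiplication by the exponent sum \<open>k\<close> of \<open>x\<^sub>1\<close> is
  nilpotent on the abelianization.  Hence iterates there become constant; the constant is a fixed
  point, and being killed by some iterate it is trivial.\<close>

lemma (in group) reaches_derived:
  assumes fg: "finitely_generated G"
  obtains d where "\<And>n w x. 1 \<le> n \<Longrightarrow> w \<in> carrier (free_group n) \<Longrightarrow> iterated_identity G n w \<Longrightarrow>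
      x \<in> {1..n} \<rightarrow> carrier G \<Longrightarrow>
      ((\<lambda>g. word_eval G (x(1 := g)) w) ^^ d) (x 1) \<in> derived G (carrier G) \<and>
      (\<forall>m\<in>derived G (carrier G). word_eval G (x(1 := m)) w \<in> derived G (carrier G))"
proof -
  let ?D = "derived G (carrier G)"
  interpret D: normal ?D G by (rule derived_self_is_normal)
  define A where "A = G Mod ?D"
  define q where "q = (\<lambda>g. ?D #> g)"
  interpret A: comm_group A unfolding A_def by (rule derived_quot_is_comm_group)
  interpret q: group_hom G A q
    by unfold_locales (use D.r_coset_hom_Mod in \<open>simp add: A_def q_def\<close>)
  have q_onto: "carrier A = q ` carrier G" by (simp add: A_def q_def carrier_FactGroup)
  have q_one: "q g = \<one>\<^bsub>A\<^esub> \<longleftrightarrow> g \<in> ?D" if "g \<in> carrier G" for g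
    using coset_join1[OF _ that D.subgroup_axioms] coset_join2[OF that D.subgroup_axioms]
    by (auto simp: A_def q_def)
  obtain S where S: "S \<subseteq> carrier G" "finite S" "generate G S = carrier G"
    using fg by (auto simp: finitely_generated_def)
  obtain K where K: "subgroup K A" "q ` S \<subseteq> K" "op_noetherian A {} K"
    using A.noetherian_finite_subset[of "q ` S"] S q.hom_closed by blast
  have "carrier A = generate A (q ` S)" using q.generate_img[OF S(1)] q_onto S(3) by simp
  then have "K = carrier A"
    using A.generate_subgroup_incl[OF K(2,1)] subgroup.subset[OF K(1)] by auto
  then have "op_noetherian A (range (\<lambda>(k :: int) a. a [^]\<^bsub>A\<^esub> k)) (carrier A)"
    using op_noetherian_mono_ops[OF K(3)] by (simp add: op_subgroup_def)
  then obtain d where d: "\<And>r c x. r \<in> range (\<lambda>(k :: int) a. a [^]\<^bsub>A\<^esub> k) \<Longrightarrow> c \<in> carrier A \<Longrightarrow>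
      (\<And>x. x \<in> carrier A \<Longrightarrow> \<exists>d\<ge>1. ((\<lambda>y. r y \<otimes>\<^bsub>A\<^esub> c) ^^ d) x = \<one>\<^bsub>A\<^esub>) \<Longrightarrow> x \<in> carrier A \<Longrightarrow>
      \<exists>d\<in>{1..d}. ((\<lambda>y. r y \<otimes>\<^bsub>A\<^esub> c) ^^ d) x = \<one>\<^bsub>A\<^esub>"
    using A.affine_uniform_bound[OF A.int_pow_commuting_ops] by blast
  show thesis
  proof (rule that[of d])
    fix n w x
    assume n: "1 \<le> n" and w: "w \<in> carrier (free_group n)" and id: "iterated_identity G n w"
      and x: "x \<in> {1..n} \<rightarrow> carrier G"
    note letters = free_group_letters[OF w]
    have closed: "((\<lambda>g. word_eval G (x(1 := g)) w) ^^ N) g \<in> carrier G"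
      if "x \<in> {1..n} \<rightarrow> carrier G" "g \<in> carrier G" for x N g
    proof (induction N)
      case (Suc N)
      show ?case unfolding funpow.simps o_apply
        by (rule word_eval_closed[OF letters fun_upd_in_funcset[OF that(1) Suc]])
    qed (use that in simp)
    obtain k :: int where k: "\<And>x a. x \<in> {1..n} \<rightarrow> carrier A \<Longrightarrow> a \<in> carrier A \<Longrightarrow>
        word_eval A (x(1 := a)) w = a [^]\<^bsub>A\<^esub> k \<otimes>\<^bsub>A\<^esub> word_eval A (x(1 := \<one>\<^bsub>A\<^esub>)) w"
      using A.word_eval_update_first[OF letters] by blast
    define r where "r = (\<lambda>a. a [^]\<^bsub>A\<^esub> k)"
    have r: "r \<in> range (\<lambda>(k :: int) a. a [^]\<^bsub>A\<^esub> k)" by (simp add: r_def)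
    have rhom: "r \<in> hom A A" using A.int_pow_commuting_ops r unfolding A.commuting_ops_def by blast
    define b where "b x = word_eval A ((\<lambda>i. q (x i))(1 := \<one>\<^bsub>A\<^esub>)) w" for x
    have step: "q (word_eval G (x(1 := g)) w) = r (q g) \<otimes>\<^bsub>A\<^esub> b x"
      if x: "x \<in> {1..n} \<rightarrow> carrier G" and g: "g \<in> carrier G" for x g
    proof -
      have "q (word_eval G (x(1 := g)) w) = word_eval A (\<lambda>i. q ((x(1 := g)) i)) w"
        by (rule q.hom_word_eval[OF letters fun_upd_in_funcset[OF x g]])
      also have "(\<lambda>i. q ((x(1 := g)) i)) = (\<lambda>i. q (x i))(1 := q g)" by (rule ext) simp
      also have "word_eval A \<dots> w = r (q g) \<otimes>\<^bsub>A\<^esub> b x"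
        unfolding r_def b_def by (rule k) (use funcset_mem[OF x] g in auto)
      finally show ?thesis .
    qed
    have iter: "q (((\<lambda>g. word_eval G (x(1 := g)) w) ^^ N) g) = ((\<lambda>y. r y \<otimes>\<^bsub>A\<^esub> b x) ^^ N) (q g)"
      if "x \<in> {1..n} \<rightarrow> carrier G" "g \<in> carrier G" for x g N
    proof (induction N)
      case (Suc N)
      show ?case unfolding funpow.simps o_apply step[OF that(1) closed[OF that]] Suc ..
    qed simp
    have hit: "\<exists>N\<ge>1. ((\<lambda>y. r y \<otimes>\<^bsub>A\<^esub> b x) ^^ N) a = \<one>\<^bsub>A\<^esub>"
      if x: "x \<in> {1..n} \<rightarrow> carrier G" and a: "a \<in> carrier A" for x a
    proof -
      obtain g where g: "g \<in> carrier G" "a = q g" using a q_onto by auto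
      obtain N where "N \<ge> 1" "((\<lambda>g. word_eval G (x(1 := g)) w) ^^ N) g = \<one>"
        using iterated_identity_funpow[OF n w id x g(1)] by blast
      then show ?thesis using iter[OF x g(1), of N] g(2) by (intro exI[of _ N]) simp
    qed
    have b1: "b (\<lambda>_. \<one>) = \<one>\<^bsub>A\<^esub>"
      by (simp add: b_def fun_upd_idem A.word_eval_one del: fun_upd_apply)
    \<comment> \<open>The map induced by \<open>w\<close> when all other variables are trivial. It
      equals \<open>r\<close> on the carrier, but the affine form matches the bound
      \<open>d\<close>.\<close>
    define \<psi> where "\<psi> = (\<lambda>y. r y \<otimes>\<^bsub>A\<^esub> \<one>\<^bsub>A\<^esub>)"
    have \<psi>1: "(\<psi> ^^ j) \<one>\<^bsub>A\<^esub> = \<one>\<^bsub>A\<^esub>" for j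
      by (induction j) (simp_all add: \<psi>_def r_def)
    have r_nil: "(r ^^ d) a = \<one>\<^bsub>A\<^esub>" if a: "a \<in> carrier A" for a
    proof -
      have "\<exists>e\<in>{1..d}. (\<psi> ^^ e) a = \<one>\<^bsub>A\<^esub>"
        unfolding \<psi>_def by (rule d[OF r A.one_closed _ a]) (use hit[of "\<lambda>_. \<one>"] b1 in auto)
      then obtain e where e: "e \<le> d" "(\<psi> ^^ e) a = \<one>\<^bsub>A\<^esub>" by auto
      \<comment> \<open>As \<open>\<psi>\<close> fixes the identity, being hit by time
        \<open>d\<close> means being trivial exactly at time \<open>d\<close>, for every
        \<open>a\<close>.\<close>
      have "(\<psi> ^^ d) a = (\<psi> ^^ (d - e + e)) a" using e by simp
      also have "\<dots> = \<one>\<^bsub>A\<^esub>" unfolding funpow_add o_apply e(2) by (rule \<psi>1)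
      finally have "(\<psi> ^^ d) a = \<one>\<^bsub>A\<^esub>" .
      moreover have "(r ^^ d) a \<in> carrier A" using hom_funpow[OF rhom] a by (auto simp: hom_def)
      ultimately show ?thesis
        using A.affine_funpow[OF rhom A.one_closed a, of d] \<psi>1[of d] by (simp add: \<psi>_def)
    qed
    define \<phi> where "\<phi> = (\<lambda>y. r y \<otimes>\<^bsub>A\<^esub> b x)"
    have bx: "b x \<in> carrier A"
      unfolding b_def by (rule A.word_eval_closed[OF letters]) (use funcset_mem[OF x] in auto)
    have \<phi>_closed: "(\<phi> ^^ N) a \<in> carrier A" if "a \<in> carrier A" for N a
      using that bx by (induction N) (simp_all add: \<phi>_def r_def)
    define z where "z = (\<phi> ^^ d) \<one>\<^bsub>A\<^esub>"
    have z: "z \<in> carrier A" unfolding z_def by (rule \<phi>_closed) simp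
    have const: "(\<phi> ^^ d) a = z" if "a \<in> carrier A" for a
      using A.affine_funpow[OF rhom bx that, of d] r_nil[OF that] z by (simp add: \<phi>_def z_def)
    have "\<phi> z = (\<phi> ^^ d) (\<phi> \<one>\<^bsub>A\<^esub>)" unfolding z_def by (simp add: funpow_swap1)
    also have "\<dots> = z" using const \<phi>_closed[of "\<one>\<^bsub>A\<^esub>" 1] by simp
    finally have \<phi>z: "\<phi> z = z" .
    then have "(\<phi> ^^ N) z = z" for N by (induction N) simp_all
    then have z1: "z = \<one>\<^bsub>A\<^esub>" using hit[OF x z] by (auto simp: \<phi>_def)
    have x1: "x 1 \<in> carrier G" using x n by auto
    show "((\<lambda>g. word_eval G (x(1 := g)) w) ^^ d) (x 1) \<in> ?D \<and>
      (\<forall>m\<in>?D. word_eval G (x(1 := m)) w \<in> ?D)"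
    proof (intro conjI ballI)
      show "((\<lambda>g. word_eval G (x(1 := g)) w) ^^ d) (x 1) \<in> ?D"
        using q_one[OF closed[OF x x1, of d]] iter[OF x x1, of d] const[of "q (x 1)"] x1 z1
        by (simp add: \<phi>_def)
      fix m assume m: "m \<in> ?D"
      then have mG: "m \<in> carrier G" by simp
      \<comment> \<open>The trivial class is the fixed point of \<open>\<phi>\<close>, so iterates
        that have entered the derived subgroup stay there.\<close>
      have "q (word_eval G (x(1 := m)) w) = \<phi> (q m)" using step[OF x mG] by (simp add: \<phi>_def)
      also have "\<dots> = \<one>\<^bsub>A\<^esub>" using q_one[OF mG] m \<phi>z z1 by simp
      finally show "word_eval G (x(1 := m)) w \<in> ?D"
        using q_one closed[OF x mG, of 1] by simp
    qed
  qed
qed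

section \<open>The uniform bound and a non-trivial identity\<close>

context metabelian_group
begin

text \<open>\<open>d1\<close> steps lead into \<open>D\<close>, and the affine map on
  \<open>D\<close> needs at most \<open>d2\<close> more. That map hits \<open>\<one>\<close> from
  every start in \<open>D\<close>, because an iterated identity allows any value of
  \<open>x_1\<close>.\<close>

lemma uniform_depth:
  assumes fg: "finitely_generated G"
  obtains d where "\<And>n w x. 1 \<le> n \<Longrightarrow> w \<in> carrier (free_group n) \<Longrightarrow> iterated_identity G n w \<Longrightarrow>
      x \<in> {1..n} \<rightarrow> carrier G \<Longrightarrow> \<exists>e\<in>{1..d}. word_eval G x (engel_iter n w e) = \<one>"
proof -
  obtain d1 where d1: "\<And>n w x. 1 \<le> n \<Longrightarrow> w \<in> carrier (free_group n) \<Longrightarrow> iterated_identity G n w \<Longrightarrow>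
      x \<in> {1..n} \<rightarrow> carrier G \<Longrightarrow>
      ((\<lambda>g. word_eval G (x(1 := g)) w) ^^ d1) (x 1) \<in> D \<and> (\<forall>m\<in>D. word_eval G (x(1 := m)) w \<in> D)"
    using reaches_derived[OF fg] by blast
  obtain d2 where d2: "\<And>r c x. r \<in> ring_ops \<Longrightarrow> c \<in> D \<Longrightarrow>
      (\<And>x. x \<in> D \<Longrightarrow> \<exists>d\<ge>1. ((\<lambda>y. r y \<otimes> c) ^^ d) x = \<one>) \<Longrightarrow> x \<in> D \<Longrightarrow>
      \<exists>d\<in>{1..d2}. ((\<lambda>y. r y \<otimes> c) ^^ d) x = \<one>"
    using M.affine_uniform_bound[OF commuting_ring_ops] derived_noetherian[OF fg] by auto
  show thesis
  proof (rule that[of "d1 + d2"])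
    fix n w x
    assume n: "1 \<le> n" and w: "w \<in> carrier (free_group n)" and id: "iterated_identity G n w"
      and x: "x \<in> {1..n} \<rightarrow> carrier G"
    define \<phi> where "\<phi> = (\<lambda>g. word_eval G (x(1 := g)) w)"
    have start: "(\<phi> ^^ d1) (x 1) \<in> D" and \<phi>D: "\<And>m. m \<in> D \<Longrightarrow> \<phi> m \<in> D"
      using d1[OF n w id x] by (auto simp: \<phi>_def)
    obtain r where r: "r \<in> ring_ops" and eq: "\<And>m. m \<in> D \<Longrightarrow> \<phi> m = r m \<otimes> \<phi> \<one>"
      using word_eval_affine[OF free_group_letters[OF w] x] unfolding \<phi>_def by blast
    have iterD: "(\<phi> ^^ N) m \<in> D" if "m \<in> D" for N m
      using that \<phi>D by (induction N) auto
    have iter: "((\<lambda>y. r y \<otimes> \<phi> \<one>) ^^ N) m = (\<phi> ^^ N) m" if "m \<in> D" for N m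
    proof (induction N)
      case (Suc N)
      show ?case unfolding funpow.simps o_apply Suc by (rule eq[OF iterD[OF that], symmetric])
    qed simp
    have "\<exists>e\<in>{1..d2}. ((\<lambda>y. r y \<otimes> \<phi> \<one>) ^^ e) ((\<phi> ^^ d1) (x 1)) = \<one>"
    proof (rule d2[OF r _ _ start])
      show "\<phi> \<one> \<in> D" by (rule \<phi>D) simp
      show "\<exists>N\<ge>1. ((\<lambda>y. r y \<otimes> \<phi> \<one>) ^^ N) m = \<one>" if "m \<in> D" for m
        using iterated_identity_funpow[OF n w id x, of m, folded \<phi>_def] iter[OF that] that by simp
    qed
    then obtain e where "e \<in> {1..d2}" "(\<phi> ^^ (e + d1)) (x 1) = \<one>"
      using iter[OF start] by (auto simp: funpow_add)
    then show "\<exists>e\<in>{1..d1 + d2}. word_eval G x (engel_iter n w e) = \<one>"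
      using word_eval_engel_iter[OF n w x, folded \<phi>_def]
      by (intro bexI[of _ "e + d1"]) auto
  qed
qed

text \<open>The word \<open>[[x_1, x_2], [x_3, x_4]]\<close> written out, which is already reduced.
  It is a law of metabelian groups, so its first iterate is trivial everywhere.\<close>

definition commutator_law :: word where
  "commutator_law =
     [(1, True), (2, True), (1, False), (2, False), (3, True), (4, True), (3, False), (4, False),
      (2, True), (1, True), (2, False), (1, False), (4, True), (3, True), (4, False), (3, False)]"

lemma commutator_law_in_free_group: "commutator_law \<in> carrier (free_group 4)"
  by (simp add: commutator_law_def free_group_def reduced_def inv_letter_def)

lemma word_eval_commutator_law:
  assumes x: "x \<in> {1..4} \<rightarrow> carrier G"
  shows "word_eval G x commutator_law = \<one>"
proof -
  have c: "x 1 \<in> carrier G" "x 2 \<in> carrier G" "x 3 \<in> carrier G" "x 4 \<in> carrier G"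
    using x by auto
  define a where "a = x 1 \<otimes> x 2 \<otimes> inv x 1 \<otimes> inv x 2"
  define b where "b = x 3 \<otimes> x 4 \<otimes> inv x 3 \<otimes> inv x 4"
  have ab: "a \<in> D" "b \<in> D" unfolding a_def b_def using commutator_D c by auto
  have car: "a \<in> carrier G" "b \<in> carrier G" using ab by auto
  have "word_eval G x commutator_law = a \<otimes> b \<otimes> inv a \<otimes> inv b"
    using c by (simp add: commutator_law_def a_def b_def m_assoc inv_mult_group)
  also have "\<dots> = b \<otimes> a \<otimes> inv a \<otimes> inv b" using D_comm[OF ab] by simp
  also have "\<dots> = \<one>" using car by (simp add: m_assoc)
  finally show ?thesis .
qed

lemma iterated_identity_commutator_law: "iterated_identity G 4 commutator_law"
  unfolding iterated_identity_def
  by (intro ballI exI[of _ 1]) (simp add: word_eval_commutator_law)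

end

lemma word_depth_ge_1: "1 \<le> word_depth G n w"
  unfolding word_depth_def by (rule Inf_greatest) auto

lemma word_depth_le:
  assumes "1 \<le> d" "\<And>x. x \<in> {1..n} \<rightarrow> carrier G \<Longrightarrow> \<exists>e\<in>{1..d}. word_eval G x (engel_iter n w e) = \<one>\<^bsub>G\<^esub>"
  shows "word_depth G n w \<le> ereal (real d)"
  unfolding word_depth_def by (rule Inf_lower) (use assms in blast)

theorem theorem1:
  fixes G :: "('a, 'b) monoid_scheme"
  assumes "group G" and "finitely_generated G" and "metabelian G"
  shows "iterationally_bounded G"
proof -
  interpret metabelian_group G
    using assms by (simp add: metabelian_group_def metabelian_group_axioms_def)
  obtain d where d: "\<And>n w x. 1 \<le> n \<Longrightarrow> w \<in> carrier (free_group n) \<Longrightarrow> iterated_identity G n w \<Longrightarrow>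
      x \<in> {1..n} \<rightarrow> carrier G \<Longrightarrow> \<exists>e\<in>{1..d}. word_eval G x (engel_iter n w e) = \<one>\<^bsub>G\<^esub>"
    using uniform_depth[OF assms(2)] by blast
  \<comment> \<open>\<open>Suc d\<close> is used because an admissible depth has to be at least
    1.\<close>
  have "iterational_depth G \<le> ereal (real (Suc d))"
    unfolding iterational_depth_def
  proof (rule Sup_least, clarify)
    fix n w assume nw: "1 \<le> n" "w \<in> carrier (free_group n)" "iterated_identity G n w"
    show "word_depth G n w \<le> ereal (real (Suc d))"
    proof (rule word_depth_le)
      fix x assume "x \<in> {1..n} \<rightarrow> carrier G"
      then obtain e where "e \<in> {1..d}" "word_eval G x (engel_iter n w e) = \<one>\<^bsub>G\<^esub>"
        using d[OF nw] by blast
      then show "\<exists>e\<in>{1..Suc d}. word_eval G x (engel_iter n w e) = \<one>\<^bsub>G\<^esub>"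
        by (intro bexI[of _ e]) simp_all
    qed simp
  qed
  moreover have "1 \<le> iterational_depth G"
  proof -
    \<comment> \<open>One non-trivial identity keeps the supremum from being that of the empty
      set.\<close>
    have "word_depth G 4 commutator_law \<le> iterational_depth G"
      unfolding iterational_depth_def
    proof (rule Sup_upper, intro CollectI exI conjI)
      show "commutator_law \<noteq> \<one>\<^bsub>free_group 4\<^esub>" by (simp add: commutator_law_def free_group_def)
    qed (use commutator_law_in_free_group iterated_identity_commutator_law in auto)
    with word_depth_ge_1 show ?thesis by (rule order.trans)
  qed
  ultimately show ?thesis
    unfolding iterationally_bounded_def by (auto intro: le_less_trans)
qed

end
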